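(* Let $p\ge2$. Suppose that $\breve\phi\in L^p(\Delta,\mu)$ with $\int\breve\phi_\omega\,d\mu_\omega=0$ for a.e. $\omega$, and that $$\Big\|\sum_{k=1}^nP_{\sigma^{-k}\omega}^k\breve\phi_{\sigma^{-k}\omega}\Big\|_{L^p(\Delta,\mu)}=O(1)\quad\text{as }n\to\infty,$$ where the sum is regarded as the function $(\omega,x)\mapsto\sum_{k=1}^n(P^k_{\sigma^{-k}\omega}\breve\phi_{\sigma^{-k}\omega})(x)$ on $\Delta$. Then there exist $\breve\psi,\breve\chi\in L^p(\Delta,\mu)$ such that for a.e. $\omega\in\Omega$, $$\breve\psi_\omega=\breve\phi_\omega-\breve\chi_{\sigma\omega}\circ F_\omega+\breve\chi_\omega,\qquad \breve\psi_\omega\in\ker P_\omega.$$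
   Context: Random tower. $(\Omega,\mathcal F,\mathbb P)$ is a probability space, $\sigma:\Omega\to\Omega$ an invertible ergodic measure-preserving transformation; $(X,\mathcal B)$ a measurable space, $\Lambda\subset X$ a measurable set with finite measure $m$; $f_\omega:X\to X$ non-singular maps, $f_\omega^n=f_{\sigma^{n-1}\omega}\circ\cdots\circ f_\omega$. For a.e. $\omega$ there are a countable partition $\{\Lambda_j(\omega)\}_j$ of $\Lambda$ and a measurable return time $R_\omega:\Lambda\to\mathbb N$, constant on each $\Lambda_j(\omega)$, with $f_\omega^{R_\omega(x)}(x)\in\Lambda$ for a.e. $\omega$ and $m$-a.e. $x\in\Lambda$. Put $\Delta_\omega=\{(x,l)\in\Lambda\times\mathbb Z_+:x\in\bigcup_j\Lambda_j(\sigma^{-l}\omega),\ 0\le l\le R_{\sigma^{-l}\omega}(x)-1\}$, with $m$ and the $\sigma$-algebra $\mathcal B_\omega$ lifted from $\Lambda$, and $F_\omega:\Delta_\omega\to\Delta_{\sigma\omega}$, $F_\omega(x,l)=(x,l+1)$ if $l+1<R_{\sigma^{-l}\omega}(x)$, $F_\omega(x,l)=(f^{l+1}_{\sigma^{-l}\omega}(x),0)$ if $l+1=R_{\sigma^{-l}\omega}(x)$. $F_\omega^n=F_{\sigma^{n-1}\omega}\circ\cdots\circ F_\omega$ and $\Delta=\bigcup_\omega\{\omega\}\times\Delta_\omega$. $\{\mu_\omega\}$ is a family of probability measures on $\Delta_\omega$, absolutely continuous w.r.t. $m$, with $(F_\omega)_*\mu_\omega=\mu_{\sigma\omega}$ for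 a.e. $\omega$; $\mu$ is the measure on $\Delta$ with $\mu(d\omega,dx)=\mu_\omega(dx)\mathbb P(d\omega)$. For a function $g$ on $\Delta$ write $g_\omega=g(\omega,\cdot)$. Transfer operators. $P_\omega$ maps $L^1(\Delta_\omega,\mu_\omega)$ to $L^1(\Delta_{\sigma\omega},\mu_{\sigma\omega})$ and is determined by $\int\psi_\omega\cdot\varphi_{\sigma\omega}\circ F_\omega\,d\mu_\omega=\int P_\omega(\psi_\omega)\,\varphi_{\sigma\omega}\,d\mu_{\sigma\omega}$ for all $\psi_\omega\in L^1(\mu_\omega)$, $\varphi_{\sigma\omega}\in L^\infty(\mu_{\sigma\omega})$; $P_\omega^i=P_{\sigma^{i-1}\omega}\circ\cdots\circ P_{\sigma\omega}\circ P_\omega$. *)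

theory Defs
  imports "HOL-Probability.Probability" "HOL-Library.Landau_Symbols"
begin

section \<open>Lebesgue spaces\<close>

text \<open>Elements are represented by measurable functions; equality of elements is equality
  almost everywhere.\<close>

definition Lp_space :: "real \<Rightarrow> 'a measure \<Rightarrow> ('a \<Rightarrow> real) set" where
  "Lp_space p M = {g \<in> borel_measurable M. integrable M (\<lambda>x. \<bar>g x\<bar> powr p)}"

definition Lp_norm :: "real \<Rightarrow> 'a measure \<Rightarrow> ('a \<Rightarrow> real) \<Rightarrow> real" where
  "Lp_norm p M g = (\<integral>x. \<bar>g x\<bar> powr p \<partial>M) powr (1 / p)"

definition Linf_space :: "'a measure \<Rightarrow> ('a \<Rightarrow> real) set" where
  "Linf_space M = {g \<in> borel_measurable M. \<exists>C. AE x in M. \<bar>g x\<bar> \<le> C}"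


section \<open>Random towers\<close>

text \<open>The data: the base space \<open>\<Omega>\<close> with its driving map \<open>\<sigma>\<close>, the space \<open>X\<close> carrying
  the reference measure \<open>m\<close>, the set \<open>\<Lambda>\<close>, the maps \<open>f\<^sub>\<omega>\<close>, the partition elements
  \<open>\<Lambda>\<^sub>j(\<omega>)\<close>, the return times \<open>R\<^sub>\<omega>\<close> (relevant on \<open>\<Lambda>\<close> only) and the fibre
  measures \<open>\<mu>\<^sub>\<omega>\<close>.\<close>

record ('w, 'x) tower_data =
  base_prob :: "'w measure"
  base_shift :: "'w \<Rightarrow> 'w"
  ref_measure :: "'x measure"
  Lam :: "'x set"
  fib_map :: "'w \<Rightarrow> 'x \<Rightarrow> 'x"
  part :: "'w \<Rightarrow> nat \<Rightarrow> 'x set"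
  ret_time :: "'w \<Rightarrow> 'x \<Rightarrow> nat"
  fib_measure :: "'w \<Rightarrow> ('x \<times> nat) measure"

definition back_shift :: "('w, 'x) tower_data \<Rightarrow> nat \<Rightarrow> 'w \<Rightarrow> 'w" where
  "back_shift T k = (inv_into (space (base_prob T)) (base_shift T)) ^^ k"

primrec fib_iter :: "('w, 'x) tower_data \<Rightarrow> nat \<Rightarrow> 'w \<Rightarrow> 'x \<Rightarrow> 'x" where
  "fib_iter T 0 \<omega> = id"
| "fib_iter T (Suc n) \<omega> = fib_map T ((base_shift T ^^ n) \<omega>) \<circ> fib_iter T n \<omega>"

definition Delta :: "('w, 'x) tower_data \<Rightarrow> 'w \<Rightarrow> ('x \<times> nat) set" where
  "Delta T \<omega> = {(x, l). x \<in> Lam T \<and> x \<in> (\<Union>j. part T (back_shift T l \<omega>) j)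
                        \<and> l < ret_time T (back_shift T l \<omega>) x}"

text \<open>\<open>F\<^sub>\<omega>\<close> maps \<open>\<Delta>\<^sub>\<omega>\<close> into \<open>\<Delta>\<^bsub>\<sigma>\<omega>\<^esub>\<close> only up to a null set.  Therefore \<open>F\<^sub>\<omega>\<close> is
  written as a total map of \<open>X \<times> \<nat>\<close>, and measures and functions on \<open>\<Delta>\<^sub>\<omega>\<close>
  are represented by measures on \<open>X \<times> \<nat>\<close> concentrated on \<open>\<Delta>\<^sub>\<omega>\<close> and by
  functions on \<open>X \<times> \<nat>\<close>.  On \<open>\<Delta>\<^sub>\<omega>\<close> the second branch is exactly the case
  \<open>l + 1 = R\<close>; the guard \<open>x \<in> \<Lambda>\<close> is vacuous there and discards the meaningless
  values of \<open>R\<close> off \<open>\<Lambda>\<close>.\<close>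

definition tower_map :: "('w, 'x) tower_data \<Rightarrow> 'w \<Rightarrow> 'x \<times> nat \<Rightarrow> 'x \<times> nat" where
  "tower_map T \<omega> = (\<lambda>(x, l).
     if x \<in> Lam T \<and> l + 1 < ret_time T (back_shift T l \<omega>) x then (x, l + 1)
     else (fib_iter T (l + 1) (back_shift T l \<omega>) x, 0))"

definition tower_space :: "('w, 'x) tower_data \<Rightarrow> ('x \<times> nat) measure" where
  "tower_space T = ref_measure T \<Otimes>\<^sub>M count_space UNIV"

text \<open>The lift of \<open>m\<close> to \<open>\<Delta>\<^sub>\<omega>\<close>.  As \<open>m\<close> need not be \<open>\<sigma>\<close>-finite on \<open>X\<close>, it is
  cut down to \<open>\<Lambda>\<close> before the product is formed.\<close>

definition lifted_ref :: "('w, 'x) tower_data \<Rightarrow> 'w \<Rightarrow> ('x \<times> nat) measure" where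
  "lifted_ref T \<omega> =
     density (density (ref_measure T) (indicator (Lam T)) \<Otimes>\<^sub>M count_space UNIV)
             (indicator (Delta T \<omega>))"

text \<open>The measure \<open>\<mu>(d\<omega>, dx) = \<mu>\<^sub>\<omega>(dx) P(d\<omega>)\<close>.\<close>

definition tower_measure :: "('w, 'x) tower_data \<Rightarrow> ('w \<times> 'x \<times> nat) measure" where
  "tower_measure T = base_prob T \<bind>
     (\<lambda>\<omega>. distr (fib_measure T \<omega>) (base_prob T \<Otimes>\<^sub>M tower_space T) (Pair \<omega>))"

text \<open>Joint measurability of \<open>(\<omega>, x) \<mapsto> f\<^sub>\<omega>(x)\<close> and \<open>(\<omega>, x) \<mapsto> R\<^sub>\<omega>(x)\<close>, and
  measurability of \<open>\<omega> \<mapsto> \<mu>\<^sub>\<omega>\<close>, are what make \<open>\<mu>\<close> and \<open>L\<^sup>p(\<Delta>, \<mu>)\<close> meaningful.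
  The \<open>\<Lambda>\<^sub>j(\<omega>)\<close> need to cover \<open>\<Lambda>\<close> only modulo \<open>m\<close>; some may be empty, so that
  finite partitions are included.  \<open>abs_cont\<close> also says that
  \<open>\<mu>\<^sub>\<omega>\<close> is concentrated on \<open>\<Delta>\<^sub>\<omega>\<close>, because the complement is null for the
  lifted measure.\<close>

locale random_tower =
  fixes T :: "('w, 'x) tower_data"
  assumes base_prob_space: "prob_space (base_prob T)"
    and shift_bij: "bij_betw (base_shift T) (space (base_prob T)) (space (base_prob T))"
    and shift_measurable: "base_shift T \<in> base_prob T \<rightarrow>\<^sub>M base_prob T"
    and shift_inv_measurable:
      "inv_into (space (base_prob T)) (base_shift T) \<in> base_prob T \<rightarrow>\<^sub>M base_prob T"
    and shift_preserving: "distr (base_prob T) (base_prob T) (base_shift T) = base_prob T"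
    and shift_ergodic:
      "\<And>A. A \<in> sets (base_prob T) \<Longrightarrow> base_shift T -` A \<inter> space (base_prob T) = A \<Longrightarrow>
         measure (base_prob T) A = 0 \<or> measure (base_prob T) A = 1"
    and Lam_measurable: "Lam T \<in> sets (ref_measure T)"
    and Lam_finite: "emeasure (ref_measure T) (Lam T) < \<infinity>"
    and fib_map_measurable:
      "(\<lambda>(\<omega>, x). fib_map T \<omega> x) \<in> base_prob T \<Otimes>\<^sub>M ref_measure T \<rightarrow>\<^sub>M ref_measure T"
    and fib_map_nonsingular:
      "\<And>\<omega>. \<omega> \<in> space (base_prob T) \<Longrightarrow>
         absolutely_continuous (ref_measure T)
           (distr (ref_measure T) (ref_measure T) (fib_map T \<omega>))"
    and part_sets:
      "AE \<omega> in base_prob T. \<forall>j. part T \<omega> j \<in> sets (ref_measure T) \<and> part T \<omega> j \<subseteq> Lam T"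
    and part_disjoint: "AE \<omega> in base_prob T. disjoint_family (part T \<omega>)"
    and part_covers:
      "AE \<omega> in base_prob T. AE x in ref_measure T. x \<in> Lam T \<longrightarrow> x \<in> (\<Union>j. part T \<omega> j)"
    and ret_time_measurable:
      "(\<lambda>(\<omega>, x). ret_time T \<omega> x)
         \<in> base_prob T \<Otimes>\<^sub>M restrict_space (ref_measure T) (Lam T) \<rightarrow>\<^sub>M count_space UNIV"
    and ret_time_pos: "AE \<omega> in base_prob T. \<forall>x \<in> Lam T. 1 \<le> ret_time T \<omega> x"
    and ret_time_const:
      "AE \<omega> in base_prob T.
         \<forall>j. \<forall>x \<in> part T \<omega> j. \<forall>y \<in> part T \<omega> j. ret_time T \<omega> x = ret_time T \<omega> y"
    and returns:
      "AE \<omega> in base_prob T. AE x in ref_measure T.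
         x \<in> Lam T \<longrightarrow> fib_iter T (ret_time T \<omega> x) \<omega> x \<in> Lam T"
    and fib_measure_kernel:
      "fib_measure T \<in> base_prob T \<rightarrow>\<^sub>M prob_algebra (tower_space T)"
    and abs_cont:
      "AE \<omega> in base_prob T. absolutely_continuous (lifted_ref T \<omega>) (fib_measure T \<omega>)"
    and equivariant:
      "AE \<omega> in base_prob T.
         distr (fib_measure T \<omega>) (tower_space T) (tower_map T \<omega>) = fib_measure T (base_shift T \<omega>)"


section \<open>Transfer operators\<close>

text \<open>\<open>is_transfer T \<omega> \<psi> g\<close> says that \<open>g\<close> is a version of \<open>P\<^sub>\<omega> \<psi>\<close>.  For almost every
  \<open>\<omega>\<close> and every integrable \<open>\<psi>\<close> such a \<open>g\<close> exists by the Radon-Nikodym theorem and is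
  unique up to null sets; \<open>transfer\<close> picks one.\<close>

definition is_transfer ::
  "('w, 'x) tower_data \<Rightarrow> 'w \<Rightarrow> ('x \<times> nat \<Rightarrow> real) \<Rightarrow> ('x \<times> nat \<Rightarrow> real) \<Rightarrow> bool" where
  "is_transfer T \<omega> \<psi> g \<longleftrightarrow>
     integrable (fib_measure T (base_shift T \<omega>)) g \<and>
     (\<forall>\<phi> \<in> Linf_space (fib_measure T (base_shift T \<omega>)).
        (\<integral>y. \<psi> y * \<phi> (tower_map T \<omega> y) \<partial>fib_measure T \<omega>)
          = (\<integral>y. g y * \<phi> y \<partial>fib_measure T (base_shift T \<omega>)))"

definition transfer ::
  "('w, 'x) tower_data \<Rightarrow> 'w \<Rightarrow> ('x \<times> nat \<Rightarrow> real) \<Rightarrow> 'x \<times> nat \<Rightarrow> real" where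
  "transfer T \<omega> \<psi> = (SOME g. is_transfer T \<omega> \<psi> g)"

primrec transfer_iter ::
  "('w, 'x) tower_data \<Rightarrow> nat \<Rightarrow> 'w \<Rightarrow> ('x \<times> nat \<Rightarrow> real) \<Rightarrow> 'x \<times> nat \<Rightarrow> real" where
  "transfer_iter T 0 \<omega> \<psi> = \<psi>"
| "transfer_iter T (Suc i) \<omega> \<psi> = transfer T ((base_shift T ^^ i) \<omega>) (transfer_iter T i \<omega> \<psi>)"

definition ker_transfer :: "('w, 'x) tower_data \<Rightarrow> 'w \<Rightarrow> ('x \<times> nat \<Rightarrow> real) set" where
  "ker_transfer T \<omega> =
     {\<psi>. integrable (fib_measure T \<omega>) \<psi> \<and>
         (AE y in fib_measure T (base_shift T \<omega>). transfer T \<omega> \<psi> y = 0)}"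

text \<open>Fibrewise constructions such as \<open>\<omega> \<mapsto> P\<^sub>\<omega> \<psi>\<^sub>\<omega>\<close> determine a function only up to
  \<open>\<mu>\<^sub>\<omega>\<close>-null sets in each fibre, so a choice of fibrewise representatives need not
  be jointly measurable.  \<open>is_version T g h\<close> says that the function \<open>g\<close> on \<open>\<Delta>\<close>
  represents the family \<open>h\<close>.\<close>

definition is_version ::
  "('w, 'x) tower_data \<Rightarrow> ('w \<times> 'x \<times> nat \<Rightarrow> real) \<Rightarrow> ('w \<Rightarrow> 'x \<times> nat \<Rightarrow> real) \<Rightarrow> bool" where
  "is_version T g h \<longleftrightarrow>
     (AE \<omega> in base_prob T. AE y in fib_measure T \<omega>. curry g \<omega> y = h \<omega> y)"

end

theory Submission
  imports Defs
begin

text \<open>The maps $F_\omega$ glue together to the skew product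
  $(\omega, y) \mapsto (\sigma\omega, F_\omega y)$, which preserves \<open>\<mu>\<close>, and the $P_\omega$ glue
  together to its transfer operator $P$.  With $S_n = \sum_{k=1}^n P^k \phi$ one has
  $P(\phi + S_n) = S_{n+1}$, so the bounded sequence $S_n$ is an orbit of the affine map
  $A x = P(\phi + x)$.  A fixed point $\chi$ of $A$ in $L^p$ solves the problem: since
  $P(\chi \circ F) = \chi$, the function $\psi = \phi - \chi \circ F + \chi$ satisfies
  $P\psi = P(\phi + \chi) - \chi = 0$.

  The Cesaro means $x_n$ of $S_0, \dots, S_{n-1}$ lie in the same $L^p$ ball as the $S_n$ and are
  almost fixed: $A x_n - x_n = (S_n - S_0)/n$.  Thus the sets $K_n$ of all $x$ in that ball
  with $\|A x - x\|_1 \le c/n$ are nonempty; they are nested and convex.  Weak compactness of the ball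
  would give a common limit.  A strong limit is obtained directly: as $p \ge 2$, the sets $K_n$
  are bounded in $L^2$, and elements $x_n \in K_n$ of almost minimal $L^2$ norm form a
  Cauchy sequence by the parallelogram identity (lemma \<open>nested_midpoint_convex_L1_limit\<close>).  A
  subsequence converges almost everywhere and in $L^1$; Fatou's lemma puts the limit into $L^p$, and
  closedness of $P$ in $L^1$ makes it a fixed point (\<open>transfer_rel_fixed_point\<close>).

  The delicate point is measurability.  The operators $P_\omega$ are defined fibre by fibre, and the
  $\sigma$-algebra of $X$ need not be countably generated.  A Radon-Nikodym derivative on the whole
  tower satisfies the defining identity of $P_\omega$ for each test function outside a null set of
  $\omega$, and these null sets cannot in general be united over all test functions.  For this reason
  no global operator is constructed.  Instead \<open>transfer_rel \<psi> g\<close> says of two integrable functions on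
  the tower that $g_{\sigma\omega}$ represents $P_\omega \psi_\omega$ for almost every $\omega$.
  This relation is linear and closed in $L^1$ (\<open>transfer_rel_L1_closed\<close>), and it holds between
  $\phi + S_n$ and $S_{n+1}$ because the $S_n$ are jointly measurable
  (\<open>transfer_rel_partial_sums\<close>).  The sets $K_n$ are therefore formed with \<open>transfer_rel\<close> in
  place of $A$, and they remain convex.\<close>

section \<open>Limits of nested convex sets in $L^2$\<close>

text \<open>Riesz-Fischer: the increments are dominated by their absolute sum, which is integrable by
  monotone convergence.\<close>

lemma L1_convergence_of_summable_increments:
  fixes x :: "nat \<Rightarrow> 'a \<Rightarrow> real"
  assumes int: "\<And>i. integrable M (x i)"
    and sum: "summable (\<lambda>i. \<integral>z. \<bar>x (Suc i) z - x i z\<bar> \<partial>M)"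
  shows "\<exists>u. integrable M u \<and> (AE z in M. (\<lambda>i. x i z) \<longlonglongrightarrow> u z) \<and>
    (\<lambda>i. \<integral>z. \<bar>x i z - u z\<bar> \<partial>M) \<longlonglongrightarrow> 0"
proof -
  define d where "d = (\<lambda>i z. x (Suc i) z - x i z)"
  have d_int: "integrable M (d i)" for i
    unfolding d_def by (intro Bochner_Integration.integrable_diff int)
  have [measurable]: "x i \<in> borel_measurable M" "d i \<in> borel_measurable M" for i
    using int d_int by auto
  have sum': "summable (\<lambda>i. \<integral>z. norm (d i z) \<partial>M)"
    using sum by (simp add: d_def)
  have "(\<integral>\<^sup>+z. (\<Sum>i. ennreal (norm (d i z))) \<partial>M) = (\<Sum>i. \<integral>\<^sup>+z. ennreal (norm (d i z)) \<partial>M)"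
    by (rule nn_integral_suminf) simp
  also have "\<dots> = (\<Sum>i. ennreal (\<integral>z. norm (d i z) \<partial>M))"
    by (intro suminf_cong nn_integral_eq_integral integrable_norm d_int) simp
  also have "\<dots> = ennreal (\<Sum>i. \<integral>z. norm (d i z) \<partial>M)"
    by (rule suminf_ennreal2[OF _ sum']) simp
  also have "\<dots> \<noteq> \<infinity>"
    by simp
  finally have "AE z in M. (\<Sum>i. ennreal (norm (d i z))) \<noteq> \<infinity>"
    by (intro nn_integral_PInf_AE) auto
  then have summ: "AE z in M. summable (\<lambda>i. norm (d i z))"
    by eventually_elim (intro summable_suminf_not_top, auto)
  define w where "w = (\<lambda>z. \<Sum>i. norm (d i z))"
  define u where "u = (\<lambda>z. x 0 z + (\<Sum>i. d i z))"
  have w_int: "integrable M w"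
    unfolding w_def
    by (rule integrable_suminf) (use d_int summ sum' in auto)
  have "integrable M (\<lambda>z. \<Sum>i. d i z)"
    by (rule integrable_suminf) (use d_int summ sum' in auto)
  then have u_int: "integrable M u"
    unfolding u_def by (intro Bochner_Integration.integrable_add int)
  have part: "x n z = x 0 z + (\<Sum>i<n. d i z)" for n z
    by (induction n) (auto simp: d_def)
  have conv: "(\<lambda>n. x n z) \<longlonglongrightarrow> u z" if "summable (\<lambda>i. norm (d i z))" for z
  proof -
    have "(\<lambda>n. x 0 z + (\<Sum>i<n. d i z)) \<longlonglongrightarrow> u z"
      unfolding u_def
      by (intro tendsto_add tendsto_const summable_LIMSEQ summable_norm_cancel[OF that])
    then show ?thesis by (simp only: part[symmetric])
  qed
  have bound: "\<bar>x n z - u z\<bar> \<le> w z" if s: "summable (\<lambda>i. norm (d i z))" for n z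
  proof -
    have "x n z - u z = - (\<Sum>i. d (i + n) z)"
      using suminf_split_initial_segment[OF summable_norm_cancel[OF s], of n]
      unfolding part[of n z] u_def by simp
    then have "\<bar>x n z - u z\<bar> = norm (\<Sum>i. d (i + n) z)" by simp
    also have "\<dots> \<le> (\<Sum>i. norm (d (i + n) z))"
      by (rule summable_norm) (rule summable_ignore_initial_segment[OF s])
    also have "\<dots> \<le> w z"
      using suminf_split_initial_segment[OF s, of n] unfolding w_def by (simp add: sum_nonneg)
    finally show ?thesis .
  qed
  have [measurable]: "u \<in> borel_measurable M" using u_int by auto
  have "(\<lambda>n. \<integral>z. \<bar>x n z - u z\<bar> \<partial>M) \<longlonglongrightarrow> (\<integral>z. 0 \<partial>M)"
  proof (rule integral_dominated_convergence[where w=w])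
    show "AE z in M. (\<lambda>n. \<bar>x n z - u z\<bar>) \<longlonglongrightarrow> 0"
      using summ by eventually_elim (use conv in \<open>auto intro!: tendsto_rabs_zero simp: LIM_zero_iff\<close>)
    show "AE z in M. norm \<bar>x n z - u z\<bar> \<le> w z" for n
      using summ by eventually_elim (use bound in auto)
  qed (use w_int in auto)
  moreover have "AE z in M. (\<lambda>i. x i z) \<longlonglongrightarrow> u z"
    using summ by eventually_elim (rule conv)
  ultimately show ?thesis using u_int by auto
qed

text \<open>If \<open>m n\<close> is the infimum of $\|x\|_2^2$ over \<open>K n\<close>, then for almost minimal
  $y_j \in K_j$ and $y_k \in K_k$ with $j \le k$ the midpoint lies in $K_j$, and the parallelogram
  identity gives $\|y_j - y_k\|_2^2 \le 2 (m_k - m_j) + o(1)$.  The sequence \<open>m\<close> is increasing and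
  bounded, so the $y_j$ are Cauchy in $L^2$.  This replaces weak compactness and yields strong
  convergence.\<close>

lemma (in finite_measure) nested_midpoint_convex_L1_limit:
  fixes K :: "nat \<Rightarrow> ('a \<Rightarrow> real) set"
  assumes dec: "decseq K"
    and ne: "\<And>n. K n \<noteq> {}"
    and mid: "\<And>n x y. x \<in> K n \<Longrightarrow> y \<in> K n \<Longrightarrow> (\<lambda>z. (x z + y z) / 2) \<in> K n"
    and meas: "\<And>x. x \<in> K 0 \<Longrightarrow> x \<in> borel_measurable M"
    and sq: "\<And>x. x \<in> K 0 \<Longrightarrow> integrable M (\<lambda>z. (x z)\<^sup>2)"
    and bd: "\<And>x. x \<in> K 0 \<Longrightarrow> (\<integral>z. (x z)\<^sup>2 \<partial>M) \<le> B"
  shows "\<exists>x u. (\<forall>i. x i \<in> K i) \<and> integrable M u \<and> (AE z in M. (\<lambda>i. x i z) \<longlonglongrightarrow> u z) \<and>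
    (\<lambda>i. \<integral>z. \<bar>x i z - u z\<bar> \<partial>M) \<longlonglongrightarrow> 0"
proof -
  define q where "q = (\<lambda>x :: 'a \<Rightarrow> real. \<integral>z. (x z)\<^sup>2 \<partial>M)"
  define m where "m = (\<lambda>n. INF x\<in>K n. q x)"
  have K0: "x \<in> K 0" if "x \<in> K n" for x n
    using decseqD[OF dec, of 0 n] that by auto
  have bb: "bdd_below (q ` K n)" for n
    by (rule bdd_belowI2[of _ 0]) (simp add: q_def)
  have m_le: "m n \<le> q x" if "x \<in> K n" for n x
    unfolding m_def by (rule cINF_lower[OF bb that])
  have "incseq m"
    unfolding incseq_def m_def
    by (intro allI impI cINF_superset_mono ne bb) (use decseqD[OF dec] in auto)
  moreover have "m n \<le> B" for n
    using ne[of n] m_le bd K0 unfolding q_def by (meson all_not_in_conv order_trans)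
  ultimately have "Cauchy m"
    using incseq_convergent LIMSEQ_imp_Cauchy by metis
  have "\<exists>x\<in>K n. q x < m n + 1 / Suc n" for n
    using cInf_lessD[of "q ` K n" "m n + 1 / Suc n"] ne[of n] by (auto simp: m_def)
  then obtain y where yK: "\<And>n. y n \<in> K n" and yq: "\<And>n. q (y n) < m n + 1 / Suc n"
    by metis
  have [measurable]: "y n \<in> borel_measurable M" for n by (rule meas[OF K0[OF yK]])
  have ysq: "integrable M (\<lambda>z. (y n z)\<^sup>2)" for n by (rule sq[OF K0[OF yK]])
  have yint: "integrable M (y n)" for n
    by (rule square_integrable_imp_integrable[OF _ ysq]) simp
  have dsq: "integrable M (\<lambda>z. (y j z - y k z)\<^sup>2)" for j k
  proof (rule Bochner_Integration.integrable_bound)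
    show "integrable M (\<lambda>z. 2 * (y j z)\<^sup>2 + 2 * (y k z)\<^sup>2)"
      using ysq by simp
    have "(y j z - y k z)\<^sup>2 \<le> 2 * (y j z)\<^sup>2 + 2 * (y k z)\<^sup>2" for z
      using zero_le_power2[of "y j z + y k z"] by (simp add: power2_sum power2_diff)
    then show "AE z in M. norm ((y j z - y k z)\<^sup>2) \<le> norm (2 * (y j z)\<^sup>2 + 2 * (y k z)\<^sup>2)"
      by simp
  qed simp
  \<comment> \<open>parallelogram identity, with the midpoint estimated from below by \<open>m j\<close>\<close>
  have par: "q (\<lambda>z. y j z - y k z) \<le> 2 * (m k - m j) + 4 / Suc j" if "j \<le> k" for j k
  proof -
    have "y k \<in> K j" using decseqD[OF dec that] yK by auto
    then have mK: "(\<lambda>z. (y j z + y k z) / 2) \<in> K j" by (intro mid yK)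
    have "q (\<lambda>z. y j z - y k z) = (\<integral>z. 2 * (y j z)\<^sup>2 + 2 * (y k z)\<^sup>2 - 4 * ((y j z + y k z) / 2)\<^sup>2 \<partial>M)"
      unfolding q_def by (intro Bochner_Integration.integral_cong) (auto simp: power2_eq_square field_simps)
    also have "\<dots> = 2 * q (y j) + 2 * q (y k) - 4 * q (\<lambda>z. (y j z + y k z) / 2)"
      unfolding q_def using ysq sq[OF K0[OF mK]] by simp
    also have "\<dots> \<le> 2 * (m j + 1 / Suc j) + 2 * (m k + 1 / Suc k) - 4 * m j"
      using yq[of j] yq[of k] m_le[OF mK] by (intro diff_mono add_mono mult_left_mono) auto
    also have "1 / real (Suc k) \<le> 1 / real (Suc j)"
      using that by (intro divide_left_mono) auto
    finally show ?thesis by (simp add: algebra_simps)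
  qed
  have small: "\<exists>N. \<forall>j\<ge>N. \<forall>k\<ge>j. q (\<lambda>z. y j z - y k z) < e" if "0 < e" for e :: real
  proof -
    obtain N1 where N1: "\<And>j k. j \<ge> N1 \<Longrightarrow> k \<ge> N1 \<Longrightarrow> \<bar>m k - m j\<bar> < e / 4"
      using metric_CauchyD[OF \<open>Cauchy m\<close>, of "e / 4"] \<open>0 < e\<close> unfolding dist_real_def
      by (metis divide_pos_pos zero_less_numeral)
    obtain N2 :: nat where N2: "8 / e < N2" using reals_Archimedean2 by blast
    have "q (\<lambda>z. y j z - y k z) < e" if "j \<ge> max N1 N2" "k \<ge> j" for j k
    proof -
      have "8 / e < real (Suc j)" using N2 that(1) by linarith
      then have "4 / Suc j < e / 2" using \<open>0 < e\<close> by (simp add: field_simps)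
      moreover have "m k - m j < e / 4" using N1[of j k] that by (simp only: abs_less_iff)
      ultimately show ?thesis using par[OF that(2)] by argo
    qed
    then show ?thesis by blast
  qed
  have "\<exists>N. \<forall>i. (\<forall>j\<ge>N i. \<forall>k\<ge>j. q (\<lambda>z. y j z - y k z) < (1/4) ^ i)"
    using small[of "(1/4) ^ i" for i] by (intro choice) auto
  then obtain N where N: "\<And>i j k. j \<ge> N i \<Longrightarrow> k \<ge> j \<Longrightarrow> q (\<lambda>z. y j z - y k z) < (1/4) ^ i"
    by blast
  \<comment> \<open>increments of size $4^{-i}$ in the squared norm are summable in $L^1$; \<open>i \<le> r i\<close> keeps
    the chosen element in \<open>K i\<close>\<close>
  define r where "r = (\<lambda>i. i + (\<Sum>j\<le>i. N j))"
  have rN: "N i \<le> r i" "i \<le> r i" "r i \<le> r (Suc i)" for i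
    unfolding r_def by (auto simp: member_le_sum trans_le_add2)
  have inc: "(\<integral>z. \<bar>y (r (Suc i)) z - y (r i) z\<bar> \<partial>M) \<le> (measure M (space M) + 1) * (1/2) ^ i" for i
  proof -
    \<comment> \<open>$2|d| \le a + d^2 / a$ with $a = 2^{-i}$\<close>
    have "(\<integral>z. \<bar>y (r (Suc i)) z - y (r i) z\<bar> \<partial>M)
        \<le> (\<integral>z. (1/2) ^ i + 2 ^ i * (y (r i) z - y (r (Suc i)) z)\<^sup>2 \<partial>M)"
    proof (rule integral_mono)
      fix z
      let ?d = "y (r i) z - y (r (Suc i)) z" and ?a = "(1/2) ^ i :: real"
      have a: "?a * 2 ^ i = 1" by (simp flip: power_mult_distrib)
      have "0 \<le> 2 ^ i * (\<bar>?d\<bar> - ?a)\<^sup>2" by simp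
      also have "\<dots> = 2 ^ i * ?d\<^sup>2 + ?a * (?a * 2 ^ i) - 2 * (?a * 2 ^ i) * \<bar>?d\<bar>"
        by (simp add: power2_eq_square algebra_simps)
      finally have "0 \<le> 2 ^ i * ?d\<^sup>2 + ?a - 2 * \<bar>?d\<bar>"
        unfolding a by simp
      moreover have "0 \<le> \<bar>?d\<bar>" by simp
      ultimately show "\<bar>y (r (Suc i)) z - y (r i) z\<bar> \<le> ?a + 2 ^ i * ?d\<^sup>2"
        unfolding abs_minus_commute[of "y (r (Suc i)) z"] by argo
    qed (use yint dsq in auto)
    also have "\<dots> = (1/2) ^ i * measure M (space M) + 2 ^ i * q (\<lambda>z. y (r i) z - y (r (Suc i)) z)"
      unfolding q_def using dsq by simp
    also have "\<dots> \<le> (1/2) ^ i * measure M (space M) + 2 ^ i * (1/4) ^ i"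
      using N[OF rN(1,3), of i] by (intro add_left_mono mult_left_mono) auto
    also have "(2::real) ^ i * (1/4) ^ i = (1/2) ^ i" by (simp flip: power_mult_distrib)
    finally show ?thesis by (simp add: algebra_simps)
  qed
  have "summable (\<lambda>i. \<integral>z. \<bar>y (r (Suc i)) z - y (r i) z\<bar> \<partial>M)"
    by (rule summable_comparison_test'[of "\<lambda>i. (measure M (space M) + 1) * (1/2) ^ i" 0])
       (use inc in \<open>auto intro!: summable_mult summable_geometric\<close>)
  from L1_convergence_of_summable_increments[of M "\<lambda>i. y (r i)", OF yint this]
  obtain u where "integrable M u" "AE z in M. (\<lambda>i. y (r i) z) \<longlonglongrightarrow> u z"
    "(\<lambda>i. \<integral>z. \<bar>y (r i) z - u z\<bar> \<partial>M) \<longlonglongrightarrow> 0" by blast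
  moreover have "y (r i) \<in> K i" for i
    using decseqD[OF dec rN(2)] yK by auto
  ultimately show ?thesis
    by (intro exI[of _ "\<lambda>i. y (r i)"] exI[of _ u]) simp
qed

section \<open>$L^p$ spaces\<close>

text \<open>Triangle inequality and convexity of the power on the open half line; if one of the
  numbers is $0$, the claim reduces to $r^p \le r$ for $r \in [0, 1]$.\<close>

lemma abs_powr_convex:
  fixes a b s t p :: real
  assumes "1 \<le> p" "0 \<le> s" "0 \<le> t" "s + t = 1"
  shows "\<bar>s * a + t * b\<bar> powr p \<le> s * \<bar>a\<bar> powr p + t * \<bar>b\<bar> powr p"
proof -
  have shrink: "(r * c) powr p \<le> r * c powr p" if "0 \<le> r" "r \<le> 1" "0 \<le> c" for r c :: real
  proof -
    have "r powr p \<le> r"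
      using that assms(1) powr_mono'[of 1 p r] by simp
    then show ?thesis
      using that by (simp add: powr_mult mult_right_mono)
  qed
  have nonneg: "(s * x + t * y) powr p \<le> s * x powr p + t * y powr p" if "0 \<le> x" "0 \<le> y" for x y
  proof -
    consider "x = 0" | "y = 0" | "0 < x" "0 < y"
      using \<open>0 \<le> x\<close> \<open>0 \<le> y\<close> by linarith
    then show ?thesis
    proof cases
      case 1
      then show ?thesis using shrink[of t y] assms that by simp
    next
      case 2
      then show ?thesis using shrink[of s x] assms that by simp
    next
      case 3
      have "((1 - t) *\<^sub>R x + t *\<^sub>R y) powr p \<le> (1 - t) * x powr p + t * y powr p"
        using 3 assms by (intro convex_onD[OF powr_convex[OF assms(1)]]) auto
      moreover have "1 - t = s" using assms(4) by simp
      ultimately show ?thesis by simp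
    qed
  qed
  have "\<bar>s * a + t * b\<bar> \<le> s * \<bar>a\<bar> + t * \<bar>b\<bar>"
    using assms abs_triangle_ineq[of "s * a" "t * b"] by (simp add: abs_mult)
  then have "\<bar>s * a + t * b\<bar> powr p \<le> (s * \<bar>a\<bar> + t * \<bar>b\<bar>) powr p"
    using assms by (intro powr_mono2) auto
  also have "\<dots> \<le> s * \<bar>a\<bar> powr p + t * \<bar>b\<bar> powr p"
    by (rule nonneg) auto
  finally show ?thesis .
qed

lemma abs_powr_le_1_plus:
  fixes a p q :: real
  assumes "0 < q" "q \<le> p"
  shows "\<bar>a\<bar> powr q \<le> 1 + \<bar>a\<bar> powr p"
proof (cases "\<bar>a\<bar> \<le> 1")
  case True
  then have "\<bar>a\<bar> powr q \<le> 1" using assms by (intro powr_le1) auto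
  then show ?thesis by (smt (verit) powr_ge_zero)
next
  case False
  then have "\<bar>a\<bar> powr q \<le> \<bar>a\<bar> powr p" using assms by (intro powr_mono) auto
  then show ?thesis by simp
qed

lemma Lp_space_combination:
  assumes "1 \<le> p" "f \<in> Lp_space p M" "g \<in> Lp_space p M" "0 \<le> s" "0 \<le> t" "s + t = 1"
  shows "(\<lambda>z. s * f z + t * g z) \<in> Lp_space p M"
    and "(\<integral>z. \<bar>s * f z + t * g z\<bar> powr p \<partial>M)
      \<le> s * (\<integral>z. \<bar>f z\<bar> powr p \<partial>M) + t * (\<integral>z. \<bar>g z\<bar> powr p \<partial>M)"
proof -
  have [measurable]: "f \<in> borel_measurable M" "g \<in> borel_measurable M"
    and int: "integrable M (\<lambda>z. \<bar>f z\<bar> powr p)" "integrable M (\<lambda>z. \<bar>g z\<bar> powr p)"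
    using assms by (auto simp: Lp_space_def)
  have bound: "\<bar>s * f z + t * g z\<bar> powr p \<le> s * \<bar>f z\<bar> powr p + t * \<bar>g z\<bar> powr p" for z
    by (rule abs_powr_convex) (use assms in auto)
  have i: "integrable M (\<lambda>z. s * \<bar>f z\<bar> powr p + t * \<bar>g z\<bar> powr p)"
    using int by simp
  have i': "integrable M (\<lambda>z. \<bar>s * f z + t * g z\<bar> powr p)"
    by (rule Bochner_Integration.integrable_bound[OF i])
       (use bound order_trans[OF powr_ge_zero bound] in auto)
  then show "(\<lambda>z. s * f z + t * g z) \<in> Lp_space p M"
    by (auto simp: Lp_space_def)
  show "(\<integral>z. \<bar>s * f z + t * g z\<bar> powr p \<partial>M)
      \<le> s * (\<integral>z. \<bar>f z\<bar> powr p \<partial>M) + t * (\<integral>z. \<bar>g z\<bar> powr p \<partial>M)"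
    using integral_mono[OF i' i bound] int by simp
qed

lemma Lp_space_scale:
  assumes "f \<in> Lp_space p M"
  shows "(\<lambda>z. c * f z) \<in> Lp_space p M"
  using assms by (auto simp: Lp_space_def abs_mult powr_mult)

lemma Lp_space_add:
  assumes "1 \<le> p" "f \<in> Lp_space p M" "g \<in> Lp_space p M"
  shows "(\<lambda>z. f z + g z) \<in> Lp_space p M"
  using Lp_space_scale[OF Lp_space_combination(1)[OF assms, of "1/2" "1/2"], of 2]
  by (simp add: algebra_simps)

lemma (in prob_space)
  assumes "f \<in> Lp_space p M" "0 < q" "q \<le> p"
  shows Lp_space_integrable_powr: "integrable M (\<lambda>z. \<bar>f z\<bar> powr q)"
    and Lp_space_integral_powr_le: "(\<integral>z. \<bar>f z\<bar> powr q \<partial>M) \<le> 1 + (\<integral>z. \<bar>f z\<bar> powr p \<partial>M)"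
proof -
  have [measurable]: "f \<in> borel_measurable M" and int: "integrable M (\<lambda>z. \<bar>f z\<bar> powr p)"
    using assms by (auto simp: Lp_space_def)
  have i: "integrable M (\<lambda>z. 1 + \<bar>f z\<bar> powr p)" using int by simp
  show i': "integrable M (\<lambda>z. \<bar>f z\<bar> powr q)"
    by (rule Bochner_Integration.integrable_bound[OF i])
       (use abs_powr_le_1_plus[OF assms(2,3)] order_trans[OF powr_ge_zero abs_powr_le_1_plus[OF assms(2,3)]] in auto)
  show "(\<integral>z. \<bar>f z\<bar> powr q \<partial>M) \<le> 1 + (\<integral>z. \<bar>f z\<bar> powr p \<partial>M)"
    using integral_mono[OF i' i abs_powr_le_1_plus[OF assms(2,3)]] int
    by (simp add: prob_space)
qed

lemma (in prob_space)
  assumes "f \<in> Lp_space p M" "1 \<le> p"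
  shows Lp_space_integrable: "integrable M f"
    and Lp_space_L1_le: "(\<integral>z. \<bar>f z\<bar> \<partial>M) \<le> 1 + (\<integral>z. \<bar>f z\<bar> powr p \<partial>M)"
proof -
  have [measurable]: "f \<in> borel_measurable M" using assms by (auto simp: Lp_space_def)
  have "integrable M (\<lambda>z. \<bar>f z\<bar>)" using Lp_space_integrable_powr[OF assms(1) _ assms(2)] by simp
  then show "integrable M f" by (rule integrable_abs_cancel) simp
  show "(\<integral>z. \<bar>f z\<bar> \<partial>M) \<le> 1 + (\<integral>z. \<bar>f z\<bar> powr p \<partial>M)"
    using Lp_space_integral_powr_le[OF assms(1) _ assms(2)] by simp
qed

text \<open>Fatou's lemma.\<close>

lemma Lp_space_AE_limit:
  assumes "0 < p" and [measurable]: "u \<in> borel_measurable M"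
    and x: "\<And>i. x i \<in> Lp_space p M" "\<And>i. (\<integral>z. \<bar>x i z\<bar> powr p \<partial>M) \<le> C"
    and lim: "AE z in M. (\<lambda>i. x i z) \<longlonglongrightarrow> u z"
  shows "u \<in> Lp_space p M"
proof -
  have [measurable]: "x i \<in> borel_measurable M" for i using x(1) by (simp add: Lp_space_def)
  have "(\<integral>\<^sup>+z. ennreal (\<bar>u z\<bar> powr p) \<partial>M) = (\<integral>\<^sup>+z. liminf (\<lambda>i. ennreal (\<bar>x i z\<bar> powr p)) \<partial>M)"
  proof (rule nn_integral_cong_AE)
    show "AE z in M. ennreal (\<bar>u z\<bar> powr p) = liminf (\<lambda>i. ennreal (\<bar>x i z\<bar> powr p))"
      using lim
    proof eventually_elim
      case (elim z)
      have "(\<lambda>i. ennreal (\<bar>x i z\<bar> powr p)) \<longlonglongrightarrow> ennreal (\<bar>u z\<bar> powr p)"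
        using assms(1) by (intro tendsto_ennrealI tendsto_powr' tendsto_rabs elim tendsto_const) auto
      then show ?case by (intro lim_imp_Liminf[symmetric]) auto
    qed
  qed
  also have "\<dots> \<le> liminf (\<lambda>i. \<integral>\<^sup>+z. ennreal (\<bar>x i z\<bar> powr p) \<partial>M)"
    by (rule nn_integral_liminf) simp
  also have "\<dots> \<le> liminf (\<lambda>i. ennreal C)"
  proof (rule Liminf_mono, rule always_eventually, rule allI)
    fix i
    have "integrable M (\<lambda>z. \<bar>x i z\<bar> powr p)" using x(1) by (simp add: Lp_space_def)
    then show "(\<integral>\<^sup>+z. ennreal (\<bar>x i z\<bar> powr p) \<partial>M) \<le> ennreal C"
      using x(2)[of i] by (simp add: nn_integral_eq_integral ennreal_leI)
  qed
  also have "\<dots> < \<infinity>" by (simp add: Liminf_const)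
  finally have "integrable M (\<lambda>z. \<bar>u z\<bar> powr p)"
    by (intro integrableI_nonneg) auto
  then show ?thesis by (simp add: Lp_space_def)
qed

text \<open>The Landau symbol bounds only a tail of the sequence, so the finitely many remaining norms
  enter the constant.\<close>

lemma Lp_norm_bounded_imp:
  assumes "0 < p" and "(\<lambda>n. Lp_norm p M (S n)) \<in> O(\<lambda>_. 1)"
  shows "\<exists>C. \<forall>n :: nat. (\<integral>z. \<bar>S n z\<bar> powr p \<partial>M) \<le> C"
proof -
  obtain c where "eventually (\<lambda>n. norm (Lp_norm p M (S n)) \<le> c) sequentially"
    using landau_o.bigE[OF assms(2)] by auto
  then have "Bseq (\<lambda>n. Lp_norm p M (S n))" by (rule BfunI)
  then obtain B where B: "\<And>n. \<bar>Lp_norm p M (S n)\<bar> \<le> B" by (auto simp: Bseq_def)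
  have "(\<integral>z. \<bar>S n z\<bar> powr p \<partial>M) \<le> B powr p" for n
  proof -
    have "0 \<le> (\<integral>z. \<bar>S n z\<bar> powr p \<partial>M)" by simp
    then have "(\<integral>z. \<bar>S n z\<bar> powr p \<partial>M) = Lp_norm p M (S n) powr p"
      using assms(1) by (simp add: Lp_norm_def powr_powr)
    also have "\<dots> \<le> B powr p"
      using assms(1) B[of n] by (intro powr_mono2) (auto simp: Lp_norm_def)
    finally show ?thesis .
  qed
  then show ?thesis by blast
qed

lemma Linf_space_measurable: 
  assumes "f \<in> Linf_space M" shows "f \<in> borel_measurable M"
  using assms by (simp add: Linf_space_def)

lemma integrable_times_Linf:
  assumes "integrable M g" "f \<in> Linf_space M"
  shows "integrable M (\<lambda>y. g y * f y :: real)"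
proof -
  obtain C where C: "AE y in M. \<bar>f y\<bar> \<le> C" and [measurable]: "f \<in> borel_measurable M"
    using assms(2) by (auto simp: Linf_space_def)
  have [measurable]: "g \<in> borel_measurable M" using assms(1) by auto
  show ?thesis
  proof (rule Bochner_Integration.integrable_bound[of _ "\<lambda>y. C * g y"])
    show "AE y in M. norm (g y * f y) \<le> norm (C * g y)"
      using C
    proof eventually_elim
      case (elim y)
      then have "\<bar>g y\<bar> * \<bar>f y\<bar> \<le> \<bar>g y\<bar> * \<bar>C\<bar>"
        by (intro mult_left_mono) auto
      then show ?case by (simp add: abs_mult mult.commute)
    qed
  qed (use assms(1) in auto)
qed

lemma bounded_in_Linf_space:
  assumes "f \<in> borel_measurable M" "\<And>y. \<bar>f y\<bar> \<le> C"
  shows "f \<in> Linf_space M"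
  using assms by (auto simp: Linf_space_def)

lemma integral_times_Linf_tendsto:
  fixes h :: "nat \<Rightarrow> 'a \<Rightarrow> real"
  assumes int: "\<And>i. integrable M (h i)" "integrable M h0" and f: "f \<in> Linf_space M"
    and lim: "(\<lambda>i. \<integral>y. \<bar>h i y - h0 y\<bar> \<partial>M) \<longlonglongrightarrow> 0"
  shows "(\<lambda>i. \<integral>y. h i y * f y \<partial>M) \<longlonglongrightarrow> (\<integral>y. h0 y * f y \<partial>M)"
proof -
  obtain C where C: "AE y in M. \<bar>f y\<bar> \<le> C" using f by (auto simp: Linf_space_def)
  have "norm ((\<integral>y. h i y * f y \<partial>M) - (\<integral>y. h0 y * f y \<partial>M)) \<le> (\<integral>y. \<bar>h i y - h0 y\<bar> \<partial>M) * C" for i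
  proof -
    have d: "integrable M (\<lambda>y. (h i y - h0 y) * f y)"
      by (intro integrable_times_Linf f Bochner_Integration.integrable_diff int)
    have "(\<integral>y. h i y * f y \<partial>M) - (\<integral>y. h0 y * f y \<partial>M) = (\<integral>y. (h i y - h0 y) * f y \<partial>M)"
      using integrable_times_Linf[OF int(1) f, of i] integrable_times_Linf[OF int(2) f]
      by (simp add: left_diff_distrib)
    also have "norm \<dots> \<le> (\<integral>y. norm ((h i y - h0 y) * f y) \<partial>M)"
      by (rule integral_norm_bound)
    also have "\<dots> \<le> (\<integral>y. \<bar>h i y - h0 y\<bar> * C \<partial>M)"
    proof (rule integral_mono_AE)
      show "AE y in M. norm ((h i y - h0 y) * f y) \<le> \<bar>h i y - h0 y\<bar> * C"
        using C by eventually_elim (auto simp: abs_mult intro: mult_left_mono)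
    qed (use d int in auto)
    finally show ?thesis by simp
  qed
  moreover have "(\<lambda>i. (\<integral>y. \<bar>h i y - h0 y\<bar> \<partial>M) * C) \<longlonglongrightarrow> 0"
    using tendsto_mult_right[OF lim, of C] by simp
  ultimately have "(\<lambda>i. (\<integral>y. h i y * f y \<partial>M) - (\<integral>y. h0 y * f y \<partial>M)) \<longlonglongrightarrow> 0"
    by (rule Lim_null_comparison[OF always_eventually, OF allI])
  then show ?thesis by (simp add: LIM_zero_iff)
qed

section \<open>The measure on the tower and the skew product\<close>

context random_tower
begin

abbreviation "\<P> \<equiv> base_prob T"
abbreviation "\<sigma> \<equiv> base_shift T"
abbreviation "\<nu> \<equiv> fib_measure T"
abbreviation "Y \<equiv> tower_space T"
abbreviation "\<mu> \<equiv> tower_measure T"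

sublocale base: prob_space "base_prob T"
  by (rule base_prob_space)

declare shift_measurable [measurable]

lemma shift_in_space: "\<omega> \<in> space \<P> \<Longrightarrow> \<sigma> \<omega> \<in> space \<P>"
  using shift_bij by (auto simp: bij_betw_def)

lemma back_shift_measurable [measurable]: "back_shift T k \<in> \<P> \<rightarrow>\<^sub>M \<P>"
  unfolding back_shift_def
  by (induction k) (auto intro: measurable_compose[OF _ shift_inv_measurable])

lemma back_shift_in_space: "\<omega> \<in> space \<P> \<Longrightarrow> back_shift T k \<omega> \<in> space \<P>"
  using measurable_space[OF back_shift_measurable] .

lemma back_shift_Suc_shift: "\<omega> \<in> space \<P> \<Longrightarrow> back_shift T (Suc k) (\<sigma> \<omega>) = back_shift T k \<omega>"
  using shift_bij by (simp add: back_shift_def funpow_swap1 bij_betw_inv_into_left)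

lemma shift_back_shift_1: "\<omega> \<in> space \<P> \<Longrightarrow> \<sigma> (back_shift T 1 \<omega>) = \<omega>"
  using shift_bij by (simp add: back_shift_def bij_betw_inv_into_right)

lemma shift_funpow_back_shift: "\<omega> \<in> space \<P> \<Longrightarrow> (\<sigma> ^^ k) (back_shift T k \<omega>) = \<omega>"
proof (induction k arbitrary: \<omega>)
  case (Suc k)
  have "back_shift T (Suc k) \<omega> = back_shift T k (back_shift T 1 \<omega>)"
    by (simp add: back_shift_def funpow_swap1)
  then show ?case
    using Suc.IH[of "back_shift T 1 \<omega>"] back_shift_in_space[OF Suc.prems, of 1]
      shift_back_shift_1[OF Suc.prems] by simp
qed (simp add: back_shift_def)

lemma AE_shift: "(AE \<omega> in \<P>. Q \<omega>) \<Longrightarrow> AE \<omega> in \<P>. Q (\<sigma> \<omega>)"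
  by (rule AE_distrD[OF shift_measurable]) (unfold shift_preserving)

lemma back_shift_preserving: "distr \<P> \<P> (back_shift T 1) = \<P>"
proof -
  have "distr \<P> \<P> (back_shift T 1) = distr (distr \<P> \<P> \<sigma>) \<P> (back_shift T 1)"
    by (simp add: shift_preserving)
  also have "\<dots> = distr \<P> \<P> (back_shift T 1 \<circ> \<sigma>)"
    by (rule distr_distr) auto
  also have "\<dots> = distr \<P> \<P> (\<lambda>\<omega>. \<omega>)"
    using back_shift_Suc_shift[of _ 0] by (intro distr_cong) (auto simp: back_shift_def)
  finally show ?thesis by simp
qed

text \<open>\<open>Q\<close> need not define a measurable set, so the claim is not read off from
  the shift being measure preserving; its inverse is used to pull the null set back.\<close>

lemma AE_unshift:
  assumes "AE \<omega> in \<P>. Q (\<sigma> \<omega>)"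
  shows "AE \<omega> in \<P>. Q \<omega>"
proof -
  have "AE \<omega> in \<P>. Q (\<sigma> (back_shift T 1 \<omega>))"
    by (rule AE_distrD[OF back_shift_measurable]) (unfold back_shift_preserving, rule assms)
  then show ?thesis
    using AE_space by eventually_elim (simp only: shift_back_shift_1)
qed

lemma fib_kernel [measurable]: "\<nu> \<in> \<P> \<rightarrow>\<^sub>M subprob_algebra Y"
  by (rule measurable_prob_algebraD[OF fib_measure_kernel])

lemma
  assumes "\<omega> \<in> space \<P>"
  shows prob_space_fib: "prob_space (\<nu> \<omega>)"
    and sets_fib: "sets (\<nu> \<omega>) = sets Y"
  using measurable_space[OF fib_measure_kernel assms]
  by (auto simp: space_prob_algebra)

lemma embedded_kernel [measurable]:
  "(\<lambda>\<omega>. distr (\<nu> \<omega>) (\<P> \<Otimes>\<^sub>M Y) (Pair \<omega>)) \<in> \<P> \<rightarrow>\<^sub>M subprob_algebra (\<P> \<Otimes>\<^sub>M Y)"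
  by (rule measurable_distr2[OF _ fib_kernel]) simp

lemma sets_tower [measurable_cong]: "sets \<mu> = sets (\<P> \<Otimes>\<^sub>M Y)"
  unfolding tower_measure_def by (rule sets_bind) (auto simp: base.not_empty)

lemma Pair_fib_measurable: "\<omega> \<in> space \<P> \<Longrightarrow> Pair \<omega> \<in> \<nu> \<omega> \<rightarrow>\<^sub>M \<P> \<Otimes>\<^sub>M Y"
  using sets_fib[of \<omega>] measurable_Pair1'[of \<omega> \<P> Y] measurable_cong_sets by blast

lemma section_measurable:
  assumes "f \<in> \<P> \<Otimes>\<^sub>M Y \<rightarrow>\<^sub>M N" "\<omega> \<in> space \<P>"
  shows "(\<lambda>y. f (\<omega>, y)) \<in> \<nu> \<omega> \<rightarrow>\<^sub>M N"
  using measurable_compose[OF Pair_fib_measurable[OF assms(2)] assms(1)] .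

lemma nn_integral_tower:
  assumes [measurable]: "f \<in> borel_measurable (\<P> \<Otimes>\<^sub>M Y)"
  shows "(\<integral>\<^sup>+z. f z \<partial>\<mu>) = (\<integral>\<^sup>+\<omega>. \<integral>\<^sup>+y. f (\<omega>, y) \<partial>\<nu> \<omega> \<partial>\<P>)"
  unfolding tower_measure_def
  by (subst nn_integral_bind[OF assms embedded_kernel])
     (auto intro!: nn_integral_cong nn_integral_distr Pair_fib_measurable)

lemma prob_space_tower: "prob_space \<mu>"
  unfolding tower_measure_def
  by (rule base.prob_space_bind[OF _ embedded_kernel])
     (auto intro!: prob_space.prob_space_distr prob_space_fib Pair_fib_measurable)

sublocale tower: prob_space "tower_measure T"
  by (rule prob_space_tower)

lemma integrable_tower_fibres:
  fixes f :: "_ \<Rightarrow> real"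
  assumes "integrable \<mu> f"
  shows "AE \<omega> in \<P>. integrable (\<nu> \<omega>) (\<lambda>y. f (\<omega>, y))"
    and "integrable \<P> (\<lambda>\<omega>. \<integral>y. \<bar>f (\<omega>, y)\<bar> \<partial>\<nu> \<omega>)"
    and "(\<integral>\<omega>. (\<integral>y. \<bar>f (\<omega>, y)\<bar> \<partial>\<nu> \<omega>) \<partial>\<P>) = (\<integral>z. \<bar>f z\<bar> \<partial>\<mu>)"
proof -
  have f [measurable]: "f \<in> borel_measurable (\<P> \<Otimes>\<^sub>M Y)"
    using assms sets_tower measurable_cong_sets by blast
  have eq: "(\<integral>\<^sup>+\<omega>. \<integral>\<^sup>+y. ennreal \<bar>f (\<omega>, y)\<bar> \<partial>\<nu> \<omega> \<partial>\<P>) = ennreal (\<integral>z. \<bar>f z\<bar> \<partial>\<mu>)"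
    using nn_integral_tower[of "\<lambda>z. ennreal \<bar>f z\<bar>"] nn_integral_eq_integral[OF integrable_abs[OF assms]]
    by simp
  have [measurable]: "(\<lambda>\<omega>. \<integral>\<^sup>+y. ennreal \<bar>f (\<omega>, y)\<bar> \<partial>\<nu> \<omega>) \<in> borel_measurable \<P>"
    by (rule nn_integral_measurable_subprob_algebra2[OF _ fib_kernel]) simp
  have m [measurable]: "(\<lambda>\<omega>. \<integral>y. \<bar>f (\<omega>, y)\<bar> \<partial>\<nu> \<omega>) \<in> borel_measurable \<P>"
  proof (subst measurable_cong)
    show "(\<lambda>\<omega>. enn2real (\<integral>\<^sup>+y. ennreal \<bar>f (\<omega>, y)\<bar> \<partial>\<nu> \<omega>)) \<in> borel_measurable \<P>"
      by measurable
    show "(\<integral>y. \<bar>f (\<omega>, y)\<bar> \<partial>\<nu> \<omega>) = enn2real (\<integral>\<^sup>+y. ennreal \<bar>f (\<omega>, y)\<bar> \<partial>\<nu> \<omega>)"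
      if "\<omega> \<in> space \<P>" for \<omega>
      using section_measurable[OF f that] by (intro integral_eq_nn_integral) auto
  qed
  have "AE \<omega> in \<P>. (\<integral>\<^sup>+y. ennreal \<bar>f (\<omega>, y)\<bar> \<partial>\<nu> \<omega>) \<noteq> \<infinity>"
    by (rule nn_integral_PInf_AE) (auto simp: eq)
  then show fib: "AE \<omega> in \<P>. integrable (\<nu> \<omega>) (\<lambda>y. f (\<omega>, y))"
    using AE_space
    by eventually_elim (use section_measurable[OF f] in \<open>auto simp: integrable_iff_bounded less_top\<close>)
  have eq': "(\<integral>\<^sup>+\<omega>. ennreal (\<integral>y. \<bar>f (\<omega>, y)\<bar> \<partial>\<nu> \<omega>) \<partial>\<P>) = ennreal (\<integral>z. \<bar>f z\<bar> \<partial>\<mu>)"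
    unfolding eq[symmetric]
    by (intro nn_integral_cong_AE, use fib in eventually_elim)
       (auto intro!: nn_integral_eq_integral[symmetric])
  then show "integrable \<P> (\<lambda>\<omega>. \<integral>y. \<bar>f (\<omega>, y)\<bar> \<partial>\<nu> \<omega>)"
    by (intro integrableI_nonneg) auto
  show "(\<integral>\<omega>. (\<integral>y. \<bar>f (\<omega>, y)\<bar> \<partial>\<nu> \<omega>) \<partial>\<P>) = (\<integral>z. \<bar>f z\<bar> \<partial>\<mu>)"
    by (subst integral_eq_nn_integral) (auto simp: eq')
qed

lemma fib_iter_measurable:
  "(\<lambda>(\<omega>, x). fib_iter T n \<omega> x) \<in> \<P> \<Otimes>\<^sub>M ref_measure T \<rightarrow>\<^sub>M ref_measure T"
proof (induction n)
  case (Suc n)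
  have [measurable]: "\<sigma> ^^ n \<in> \<P> \<rightarrow>\<^sub>M \<P>"
    by (induction n) (auto intro: measurable_compose)
  note Suc[measurable]
  have "(\<lambda>z. ((\<sigma> ^^ n) (fst z), fib_iter T n (fst z) (snd z)))
      \<in> \<P> \<Otimes>\<^sub>M ref_measure T \<rightarrow>\<^sub>M \<P> \<Otimes>\<^sub>M ref_measure T"
    by measurable
  from measurable_compose[OF this fib_map_measurable] show ?case
    by (simp add: split_beta')
qed (simp add: split_beta')

text \<open>The return time is measurable only over \<open>\<Lambda>\<close>; guarding it by membership in \<open>\<Lambda>\<close> gives a
  measurable condition on the whole product.\<close>

lemma ret_time_set_measurable:
  "{z \<in> space (\<P> \<Otimes>\<^sub>M ref_measure T). snd z \<in> Lam T \<and> n < ret_time T (fst z) (snd z)}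
     \<in> sets (\<P> \<Otimes>\<^sub>M ref_measure T)"
proof -
  let ?PX = "\<P> \<Otimes>\<^sub>M ref_measure T"
  let ?D = "{z. snd z \<in> Lam T}"
  note Lam_measurable [measurable]
  have D: "?D \<inter> space ?PX \<in> sets ?PX"
  proof -
    have "?D \<inter> space ?PX = {z \<in> space ?PX. snd z \<in> Lam T}" by auto
    also have "\<dots> \<in> sets ?PX" by measurable
    finally show ?thesis .
  qed
  have "(\<lambda>z. z) \<in> restrict_space ?PX ?D \<rightarrow>\<^sub>M \<P> \<Otimes>\<^sub>M restrict_space (ref_measure T) (Lam T)"
  proof (rule measurable_Pair[where f=fst and g=snd, simplified])
    show "fst \<in> restrict_space ?PX ?D \<rightarrow>\<^sub>M \<P>"
      by (rule measurable_restrict_space1) simp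
    show "snd \<in> restrict_space ?PX ?D \<rightarrow>\<^sub>M restrict_space (ref_measure T) (Lam T)"
      by (intro measurable_restrict_space2 measurable_restrict_space1)
         (auto simp: space_restrict_space)
  qed
  from measurable_compose[OF this ret_time_measurable]
  have [measurable]: "(\<lambda>z. ret_time T (fst z) (snd z)) \<in> restrict_space ?PX ?D \<rightarrow>\<^sub>M count_space UNIV"
    by (simp add: split_beta')
  have "{z \<in> space (restrict_space ?PX ?D). n < ret_time T (fst z) (snd z)} \<in> sets (restrict_space ?PX ?D)"
    by measurable
  moreover have "{z \<in> space (restrict_space ?PX ?D). n < ret_time T (fst z) (snd z)}
      = {z \<in> space ?PX. snd z \<in> Lam T \<and> n < ret_time T (fst z) (snd z)}"
    by (auto simp: space_restrict_space)
  ultimately show ?thesis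
    unfolding sets_restrict_space_iff[OF D] by simp
qed

text \<open>For a fixed level \<open>l\<close> the tower map is a case distinction between two measurable maps; countably
  many levels are then pasted together.\<close>

lemma tower_map_measurable:
  "(\<lambda>(\<omega>, y). tower_map T \<omega> y) \<in> \<P> \<Otimes>\<^sub>M Y \<rightarrow>\<^sub>M Y"
proof -
  let ?PY = "\<P> \<Otimes>\<^sub>M Y"
  define br where "br = (\<lambda>(l::nat) (z :: 'w \<times> 'x \<times> nat).
    let \<eta> = back_shift T l (fst z); x = fst (snd z) in
    if x \<in> Lam T \<and> l + 1 < ret_time T \<eta> x then (x, l + 1) else (fib_iter T (l + 1) \<eta> x, 0))"
  have coord [measurable]: "(\<lambda>z. fst (snd z)) \<in> ?PY \<rightarrow>\<^sub>M ref_measure T"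
    "(\<lambda>z. snd (snd z)) \<in> ?PY \<rightarrow>\<^sub>M count_space UNIV"
    unfolding tower_space_def by measurable
  have "br l \<in> ?PY \<rightarrow>\<^sub>M Y" for l
  proof -
    have b [measurable]: "(\<lambda>z. (back_shift T l (fst z), fst (snd z))) \<in> ?PY \<rightarrow>\<^sub>M \<P> \<Otimes>\<^sub>M ref_measure T"
      by measurable
    have "{z \<in> space ?PY. fst (snd z) \<in> Lam T \<and> l + 1 < ret_time T (back_shift T l (fst z)) (fst (snd z))} \<in> sets ?PY"
      (is "?A \<in> _")
    proof -
      have "?A = (\<lambda>z. (back_shift T l (fst z), fst (snd z))) -`
          {z \<in> space (\<P> \<Otimes>\<^sub>M ref_measure T). snd z \<in> Lam T \<and> l + 1 < ret_time T (fst z) (snd z)}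
          \<inter> space ?PY"
        using measurable_space[OF b] by auto
      then show ?thesis
        using measurable_sets[OF b ret_time_set_measurable[of "l + 1"]] by simp
    qed
    moreover have "(\<lambda>z. (fib_iter T (l + 1) (back_shift T l (fst z)) (fst (snd z)), 0)) \<in> ?PY \<rightarrow>\<^sub>M Y"
      using measurable_compose[OF b fib_iter_measurable[of "l + 1"]]
      unfolding tower_space_def by (auto simp: split_beta')
    moreover have "(\<lambda>z. (fst (snd z), l + 1)) \<in> ?PY \<rightarrow>\<^sub>M Y"
      using coord(1) unfolding tower_space_def by auto
    ultimately show ?thesis
      unfolding br_def Let_def by (intro measurable_If)
  qed
  then have "(\<lambda>z. br (snd (snd z)) z) \<in> ?PY \<rightarrow>\<^sub>M Y"
    by (rule measurable_compose_countable) (rule coord)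
  also have "(\<lambda>z. br (snd (snd z)) z) = (\<lambda>(\<omega>, y). tower_map T \<omega> y)"
    by (auto simp: br_def tower_map_def Let_def fun_eq_iff)
  finally show ?thesis .
qed

definition skew_map :: "'w \<times> 'x \<times> nat \<Rightarrow> 'w \<times> 'x \<times> nat" where
  "skew_map = (\<lambda>(\<omega>, y). (\<sigma> \<omega>, tower_map T \<omega> y))"

lemma skew_map_apply: "skew_map (\<omega>, y) = (\<sigma> \<omega>, tower_map T \<omega> y)"
  by (simp add: skew_map_def)

lemma skew_map_measurable [measurable]: "skew_map \<in> \<P> \<Otimes>\<^sub>M Y \<rightarrow>\<^sub>M \<P> \<Otimes>\<^sub>M Y"
  using tower_map_measurable unfolding skew_map_def by (auto simp: split_beta')

definition equivariant_at :: "'w \<Rightarrow> bool" where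
  "equivariant_at \<omega> \<longleftrightarrow> \<omega> \<in> space \<P> \<and> distr (\<nu> \<omega>) Y (tower_map T \<omega>) = \<nu> (\<sigma> \<omega>)"

lemma AE_equivariant_at: "AE \<omega> in \<P>. equivariant_at \<omega>"
  using equivariant AE_space by eventually_elim (simp add: equivariant_at_def)

lemma tower_map_fib_measurable:
  assumes "\<omega> \<in> space \<P>"
  shows "tower_map T \<omega> \<in> \<nu> \<omega> \<rightarrow>\<^sub>M Y"
  using section_measurable[OF tower_map_measurable assms] by simp

text \<open>The equivariance of the fibre measures moves the inner integral from \<open>\<omega>\<close> to \<open>\<sigma> \<omega>\<close>, and the
  outer one is invariant under \<open>\<sigma>\<close>.\<close>

lemma distr_skew_map: "distr \<mu> (\<P> \<Otimes>\<^sub>M Y) skew_map = \<mu>"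
proof (rule measure_eqI)
  fix A assume "A \<in> sets (distr \<mu> (\<P> \<Otimes>\<^sub>M Y) skew_map)"
  then have A [measurable]: "A \<in> sets (\<P> \<Otimes>\<^sub>M Y)" by simp
  define h where "h = (\<lambda>\<omega>. \<integral>\<^sup>+y. indicator A (\<omega>, y) \<partial>\<nu> \<omega>)"
  have [measurable]: "h \<in> borel_measurable \<P>"
    unfolding h_def by (rule nn_integral_measurable_subprob_algebra2[OF _ fib_kernel]) simp
  have "emeasure (distr \<mu> (\<P> \<Otimes>\<^sub>M Y) skew_map) A
      = (\<integral>\<^sup>+z. indicator A z \<partial>distr \<mu> (\<P> \<Otimes>\<^sub>M Y) skew_map)"
    by simp
  also have "\<dots> = (\<integral>\<^sup>+z. indicator A (skew_map z) \<partial>\<mu>)"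
    by (rule nn_integral_distr) auto
  also have "\<dots> = (\<integral>\<^sup>+\<omega>. \<integral>\<^sup>+y. indicator A (\<sigma> \<omega>, tower_map T \<omega> y) \<partial>\<nu> \<omega> \<partial>\<P>)"
    by (subst nn_integral_tower) (auto simp: skew_map_apply)
  also have "\<dots> = (\<integral>\<^sup>+\<omega>. h (\<sigma> \<omega>) \<partial>\<P>)"
  proof (rule nn_integral_cong_AE)
    show "AE \<omega> in \<P>. (\<integral>\<^sup>+y. indicator A (\<sigma> \<omega>, tower_map T \<omega> y) \<partial>\<nu> \<omega>) = h (\<sigma> \<omega>)"
      using AE_equivariant_at
    proof eventually_elim
      case (elim \<omega>)
      then have \<omega>: "\<omega> \<in> space \<P>" "\<nu> (\<sigma> \<omega>) = distr (\<nu> \<omega>) Y (tower_map T \<omega>)"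
        by (auto simp: equivariant_at_def)
      have "(\<lambda>y. indicator A (\<sigma> \<omega>, y) :: ennreal) \<in> borel_measurable Y"
        using shift_in_space[OF \<omega>(1)] by measurable
      then show ?case
        unfolding h_def \<omega>(2) by (subst nn_integral_distr[OF tower_map_fib_measurable[OF \<omega>(1)]]) auto
    qed
  qed
  also have "\<dots> = (\<integral>\<^sup>+\<omega>. h \<omega> \<partial>\<P>)"
    using nn_integral_distr[OF shift_measurable, of h] by (simp add: shift_preserving)
  also have "\<dots> = emeasure \<mu> A"
    unfolding h_def by (subst nn_integral_tower[symmetric]) (auto simp: sets_tower)
  finally show "emeasure (distr \<mu> (\<P> \<Otimes>\<^sub>M Y) skew_map) A = emeasure \<mu> A" .
qed (simp add: sets_tower)

lemma skew_map_measurable_tower: "skew_map \<in> \<mu> \<rightarrow>\<^sub>M \<mu>"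
  using skew_map_measurable sets_tower measurable_cong_sets by blast

lemma Lp_space_skew_map:
  assumes "u \<in> Lp_space p \<mu>"
  shows "(\<lambda>z. u (skew_map z)) \<in> Lp_space p \<mu>"
proof -
  have [measurable]: "u \<in> borel_measurable \<mu>" and int: "integrable \<mu> (\<lambda>z. \<bar>u z\<bar> powr p)"
    using assms by (auto simp: Lp_space_def)
  note skew_map_measurable_tower [measurable]
  have "distr \<mu> \<mu> skew_map = \<mu>"
    using distr_cong[OF refl sets_tower refl, of \<mu> skew_map] distr_skew_map by simp
  then have "integrable \<mu> (\<lambda>z. \<bar>u (skew_map z)\<bar> powr p)"
    using integrable_distr[OF skew_map_measurable_tower, of "\<lambda>z. \<bar>u z\<bar> powr p"] int by simp
  then show ?thesis by (simp add: Lp_space_def)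
qed

section \<open>Transfer operators on the fibres\<close>

lemma shift_fibre_facts:
  assumes "equivariant_at \<omega>"
  shows "\<omega> \<in> space \<P>" "tower_map T \<omega> \<in> \<nu> \<omega> \<rightarrow>\<^sub>M \<nu> (\<sigma> \<omega>)"
    "distr (\<nu> \<omega>) (\<nu> (\<sigma> \<omega>)) (tower_map T \<omega>) = \<nu> (\<sigma> \<omega>)"
proof -
  show \<omega>: "\<omega> \<in> space \<P>" using assms by (simp add: equivariant_at_def)
  show "tower_map T \<omega> \<in> \<nu> \<omega> \<rightarrow>\<^sub>M \<nu> (\<sigma> \<omega>)"
    using tower_map_fib_measurable[OF \<omega>] sets_fib[OF shift_in_space[OF \<omega>]]
      measurable_cong_sets by blast
  show "distr (\<nu> \<omega>) (\<nu> (\<sigma> \<omega>)) (tower_map T \<omega>) = \<nu> (\<sigma> \<omega>)"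
  proof -
    have "distr (\<nu> \<omega>) (\<nu> (\<sigma> \<omega>)) (tower_map T \<omega>) = distr (\<nu> \<omega>) Y (tower_map T \<omega>)"
      by (rule distr_cong[OF refl sets_fib[OF shift_in_space[OF \<omega>]] refl])
    then show ?thesis using assms by (simp add: equivariant_at_def)
  qed
qed

lemma Linf_space_tower_map:
  assumes "equivariant_at \<omega>" "f \<in> Linf_space (\<nu> (\<sigma> \<omega>))"
  shows "(\<lambda>y. f (tower_map T \<omega> y)) \<in> Linf_space (\<nu> \<omega>)"
proof -
  note F = shift_fibre_facts[OF assms(1)]
  obtain C where C: "AE y in \<nu> (\<sigma> \<omega>). \<bar>f y\<bar> \<le> C" and "f \<in> borel_measurable (\<nu> (\<sigma> \<omega>))"
    using assms(2) by (auto simp: Linf_space_def)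
  then have "(\<lambda>y. f (tower_map T \<omega> y)) \<in> borel_measurable (\<nu> \<omega>)"
    using F(2) by measurable
  moreover have "AE y in \<nu> \<omega>. \<bar>f (tower_map T \<omega> y)\<bar> \<le> C"
    by (rule AE_distrD[OF F(2)]) (unfold F(3), rule C)
  ultimately show ?thesis by (auto simp: Linf_space_def)
qed

lemma is_transfer_linear:
  assumes "equivariant_at \<omega>"
    and "integrable (\<nu> \<omega>) \<psi>1" "is_transfer T \<omega> \<psi>1 g1"
    and "integrable (\<nu> \<omega>) \<psi>2" "is_transfer T \<omega> \<psi>2 g2"
  shows "is_transfer T \<omega> (\<lambda>y. a * \<psi>1 y + b * \<psi>2 y) (\<lambda>y. a * g1 y + b * g2 y)"
  unfolding is_transfer_def
proof (intro conjI ballI)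
  have g: "integrable (\<nu> (\<sigma> \<omega>)) g1" "integrable (\<nu> (\<sigma> \<omega>)) g2"
    using assms(3,5) by (auto simp: is_transfer_def)
  then show "integrable (\<nu> (\<sigma> \<omega>)) (\<lambda>y. a * g1 y + b * g2 y)" by simp
  fix f assume f: "f \<in> Linf_space (\<nu> (\<sigma> \<omega>))"
  note fF = Linf_space_tower_map[OF assms(1) f]
  have "(\<integral>y. (a * \<psi>1 y + b * \<psi>2 y) * f (tower_map T \<omega> y) \<partial>\<nu> \<omega>)
      = (\<integral>y. a * (\<psi>1 y * f (tower_map T \<omega> y)) + b * (\<psi>2 y * f (tower_map T \<omega> y)) \<partial>\<nu> \<omega>)"
    by (simp add: algebra_simps)
  also have "\<dots> = a * (\<integral>y. \<psi>1 y * f (tower_map T \<omega> y) \<partial>\<nu> \<omega>) + b * (\<integral>y. \<psi>2 y * f (tower_map T \<omega> y) \<partial>\<nu> \<omega>)"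
    using integrable_times_Linf[OF assms(2) fF] integrable_times_Linf[OF assms(4) fF] by simp
  also have "\<dots> = a * (\<integral>y. g1 y * f y \<partial>\<nu> (\<sigma> \<omega>)) + b * (\<integral>y. g2 y * f y \<partial>\<nu> (\<sigma> \<omega>))"
    using assms(3,5) f by (simp add: is_transfer_def)
  also have "\<dots> = (\<integral>y. a * (g1 y * f y) + b * (g2 y * f y) \<partial>\<nu> (\<sigma> \<omega>))"
    using integrable_times_Linf[OF g(1) f] integrable_times_Linf[OF g(2) f] by simp
  also have "\<dots> = (\<integral>y. (a * g1 y + b * g2 y) * f y \<partial>\<nu> (\<sigma> \<omega>))"
    by (simp add: algebra_simps)
  finally show "(\<integral>y. (a * \<psi>1 y + b * \<psi>2 y) * f (tower_map T \<omega> y) \<partial>\<nu> \<omega>)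
      = (\<integral>y. (a * g1 y + b * g2 y) * f y \<partial>\<nu> (\<sigma> \<omega>))" .
qed

text \<open>$P_\omega (g \circ F_\omega) = g$, because $F_\omega$ maps $\mu_\omega$ to
  $\mu_{\sigma\omega}$.\<close>

lemma is_transfer_composition:
  assumes "equivariant_at \<omega>" "integrable (\<nu> (\<sigma> \<omega>)) g"
  shows "is_transfer T \<omega> (\<lambda>y. g (tower_map T \<omega> y)) g"
  unfolding is_transfer_def
proof (intro conjI ballI assms(2))
  fix f assume "f \<in> Linf_space (\<nu> (\<sigma> \<omega>))"
  then have "(\<lambda>y. g y * f y) \<in> borel_measurable (\<nu> (\<sigma> \<omega>))"
    using assms(2) by (auto simp: Linf_space_def)
  from integral_distr[OF shift_fibre_facts(2)[OF assms(1)] this]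
  show "(\<integral>y. g (tower_map T \<omega> y) * f (tower_map T \<omega> y) \<partial>\<nu> \<omega>) = (\<integral>y. g y * f y \<partial>\<nu> (\<sigma> \<omega>))"
    unfolding shift_fibre_facts(3)[OF assms(1)] by simp
qed

text \<open>$P_\omega \psi$ is the density of the image measure $(F_\omega)_* (\psi \mu_\omega)$ with respect to
  $\mu_{\sigma\omega} = (F_\omega)_* \mu_\omega$.\<close>

lemma is_transfer_exists_nonneg:
  assumes "equivariant_at \<omega>" "integrable (\<nu> \<omega>) \<psi>" "\<And>y. 0 \<le> \<psi> y"
  shows "\<exists>g. is_transfer T \<omega> \<psi> g"
proof -
  let ?M = "\<nu> \<omega>" and ?N = "\<nu> (\<sigma> \<omega>)" and ?F = "tower_map T \<omega>"
  note F = shift_fibre_facts[OF assms(1)]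
  note F(2) [measurable]
  have [measurable]: "\<psi> \<in> borel_measurable ?M" using assms(2) by auto
  interpret N: prob_space ?N
    by (rule prob_space_fib[OF shift_in_space[OF F(1)]])
  define D where "D = distr (density ?M (\<lambda>y. ennreal (\<psi> y))) ?N ?F"
  have D_sets: "sets D = sets ?N" by (simp add: D_def)
  have "absolutely_continuous ?N D"
    unfolding absolutely_continuous_def
  proof
    fix A assume A: "A \<in> null_sets ?N"
    then have [measurable]: "A \<in> sets ?N" by auto
    have "emeasure ?M (?F -` A \<inter> space ?M) = emeasure (distr ?M ?N ?F) A"
      by (simp add: emeasure_distr)
    also have "\<dots> = 0" using A F(3) by auto
    finally have null: "?F -` A \<inter> space ?M \<in> null_sets ?M" by auto
    have "?F -` A \<inter> space ?M \<in> null_sets (density ?M (\<lambda>y. ennreal (\<psi> y)))"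
      using absolutely_continuousI_density[of "\<lambda>y. ennreal (\<psi> y)" ?M] null
      by (auto simp: absolutely_continuous_def)
    then have "emeasure D A = 0"
      by (simp add: D_def emeasure_distr null_setsD1)
    then show "A \<in> null_sets D" using D_sets by auto
  qed
  from N.density_RN_deriv[OF this D_sets] have dens: "density ?N (RN_deriv ?N D) = D" .
  have "(\<integral>\<^sup>+y. RN_deriv ?N D y \<partial>?N) = emeasure (density ?N (RN_deriv ?N D)) (space ?N)"
    by (simp add: emeasure_density cong: nn_integral_cong)
  also have "\<dots> = emeasure D (space ?N)"
    by (simp only: dens)
  also have "\<dots> = (\<integral>\<^sup>+y. ennreal (\<psi> y) \<partial>?M)"
    using measurable_space[OF F(2)]
    by (simp add: D_def emeasure_distr emeasure_density)
       (intro nn_integral_cong, simp add: indicator_def)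
  finally have fin: "(\<integral>\<^sup>+y. RN_deriv ?N D y \<partial>?N) < \<infinity>"
    using assms(2,3) by (simp add: nn_integral_eq_integral)
  define g where "g = (\<lambda>y. enn2real (RN_deriv ?N D y))"
  have [measurable]: "g \<in> borel_measurable ?N" unfolding g_def by measurable
  have "AE y in ?N. RN_deriv ?N D y \<noteq> \<infinity>"
    using fin by (intro nn_integral_PInf_AE) auto
  then have ae: "AE y in ?N. RN_deriv ?N D y = ennreal (g y)"
    by eventually_elim (simp add: g_def less_top)
  have densg: "density ?N (\<lambda>y. ennreal (g y)) = D"
    using density_cong[OF _ _ ae] dens by simp
  have "(\<integral>\<^sup>+y. ennreal (g y) \<partial>?N) = (\<integral>\<^sup>+y. RN_deriv ?N D y \<partial>?N)"
    using ae by (intro nn_integral_cong_AE) auto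
  then have "integrable ?N g"
    using fin by (intro integrableI_nonneg) (auto simp: g_def)
  moreover have "(\<integral>y. \<psi> y * f (?F y) \<partial>?M) = (\<integral>y. g y * f y \<partial>?N)" if "f \<in> Linf_space ?N" for f
  proof -
    have [measurable]: "f \<in> borel_measurable ?N" using that by (simp add: Linf_space_def)
    have "(\<integral>y. \<psi> y * f (?F y) \<partial>?M) = integral\<^sup>L (density ?M (\<lambda>y. ennreal (\<psi> y))) (\<lambda>y. f (?F y))"
      using assms(3) by (subst integral_density) auto
    also have "\<dots> = integral\<^sup>L D f"
      unfolding D_def by (rule integral_distr[symmetric]) auto
    also have "\<dots> = (\<integral>y. g y * f y \<partial>?N)"
      unfolding densg[symmetric] by (subst integral_density) (auto simp: g_def)
    finally show ?thesis .
  qed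
  ultimately show ?thesis unfolding is_transfer_def by blast
qed

lemma is_transfer_transfer:
  assumes "equivariant_at \<omega>" "integrable (\<nu> \<omega>) \<psi>"
  shows "is_transfer T \<omega> \<psi> (transfer T \<omega> \<psi>)"
proof -
  have int: "integrable (\<nu> \<omega>) (\<lambda>y. max (\<psi> y) 0)" "integrable (\<nu> \<omega>) (\<lambda>y. max (- \<psi> y) 0)"
    using assms(2) by auto
  obtain g1 g2 where "is_transfer T \<omega> (\<lambda>y. max (\<psi> y) 0) g1" "is_transfer T \<omega> (\<lambda>y. max (- \<psi> y) 0) g2"
    using is_transfer_exists_nonneg[OF assms(1) int(1)] is_transfer_exists_nonneg[OF assms(1) int(2)]
    by auto
  from is_transfer_linear[OF assms(1) int(1) this(1) int(2) this(2), of 1 "-1"]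
  have "is_transfer T \<omega> (\<lambda>y. max (\<psi> y) 0 - max (- \<psi> y) 0) (\<lambda>y. g1 y - g2 y)" by simp
  also have "(\<lambda>y. max (\<psi> y) 0 - max (- \<psi> y) 0) = \<psi>" by (auto simp: fun_eq_iff max_def)
  finally show ?thesis unfolding transfer_def by (rule someI[where P="is_transfer T \<omega> \<psi>"])
qed

text \<open>Test both versions against the sign of their difference.\<close>

lemma is_transfer_unique:
  assumes g: "is_transfer T \<omega> \<psi> g" and g': "is_transfer T \<omega> \<psi> g'"
  shows "AE y in \<nu> (\<sigma> \<omega>). g y = g' y"
proof -
  let ?N = "\<nu> (\<sigma> \<omega>)" and ?s = "\<lambda>y. sgn (g y - g' y)"
  have int: "integrable ?N g" "integrable ?N g'" using g g' by (auto simp: is_transfer_def)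
  then have [measurable]: "g \<in> borel_measurable ?N" "g' \<in> borel_measurable ?N" by auto
  have s: "?s \<in> Linf_space ?N"
    by (rule bounded_in_Linf_space[of _ _ 1]) (auto simp: sgn_if)
  have "(\<integral>y. \<bar>g y - g' y\<bar> \<partial>?N) = (\<integral>y. g y * ?s y - g' y * ?s y \<partial>?N)"
    by (intro Bochner_Integration.integral_cong) (auto simp: sgn_if)
  also have "\<dots> = (\<integral>y. g y * ?s y \<partial>?N) - (\<integral>y. g' y * ?s y \<partial>?N)"
    by (rule Bochner_Integration.integral_diff) (intro integrable_times_Linf int s)+
  also have "(\<integral>y. g y * ?s y \<partial>?N) = (\<integral>y. \<psi> y * ?s (tower_map T \<omega> y) \<partial>\<nu> \<omega>)"
    by (rule bspec[OF conjunct2[OF g[unfolded is_transfer_def]] s, symmetric])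
  also have "(\<integral>y. g' y * ?s y \<partial>?N) = (\<integral>y. \<psi> y * ?s (tower_map T \<omega> y) \<partial>\<nu> \<omega>)"
    by (rule bspec[OF conjunct2[OF g'[unfolded is_transfer_def]] s, symmetric])
  finally have "(\<integral>y. \<bar>g y - g' y\<bar> \<partial>?N) = 0" by simp
  then have "AE y in ?N. \<bar>g y - g' y\<bar> = 0"
    using int by (subst (asm) integral_nonneg_eq_0_iff_AE) auto
  then show ?thesis by eventually_elim simp
qed

lemma is_transfer_cong_AE:
  assumes "is_transfer T \<omega> \<psi> g" "equivariant_at \<omega>"
    and \<psi>: "integrable (\<nu> \<omega>) \<psi>" "integrable (\<nu> \<omega>) \<psi>'" "AE y in \<nu> \<omega>. \<psi> y = \<psi>' y"
    and g: "integrable (\<nu> (\<sigma> \<omega>)) g'" "AE y in \<nu> (\<sigma> \<omega>). g y = g' y"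
  shows "is_transfer T \<omega> \<psi>' g'"
  unfolding is_transfer_def
proof (intro conjI ballI g(1))
  fix f assume f: "f \<in> Linf_space (\<nu> (\<sigma> \<omega>))"
  have g0: "integrable (\<nu> (\<sigma> \<omega>)) g" using assms(1) by (simp add: is_transfer_def)
  note fF = Linf_space_tower_map[OF assms(2) f]
  note [measurable] = borel_measurable_integrable[OF \<psi>(1)] borel_measurable_integrable[OF \<psi>(2)]
    borel_measurable_integrable[OF g(1)] borel_measurable_integrable[OF g0]
    Linf_space_measurable[OF f] Linf_space_measurable[OF fF]
  have "(\<integral>y. \<psi>' y * f (tower_map T \<omega> y) \<partial>\<nu> \<omega>) = (\<integral>y. \<psi> y * f (tower_map T \<omega> y) \<partial>\<nu> \<omega>)"
  proof (rule integral_cong_AE)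
    show "AE y in \<nu> \<omega>. \<psi>' y * f (tower_map T \<omega> y) = \<psi> y * f (tower_map T \<omega> y)"
      using \<psi>(3) by eventually_elim simp
  qed measurable
  also have "\<dots> = (\<integral>y. g y * f y \<partial>\<nu> (\<sigma> \<omega>))"
    using assms(1) f by (simp add: is_transfer_def)
  also have "\<dots> = (\<integral>y. g' y * f y \<partial>\<nu> (\<sigma> \<omega>))"
  proof (rule integral_cong_AE)
    show "AE y in \<nu> (\<sigma> \<omega>). g y * f y = g' y * f y"
      using g(2) by eventually_elim simp
  qed measurable
  finally show "(\<integral>y. \<psi>' y * f (tower_map T \<omega> y) \<partial>\<nu> \<omega>) = (\<integral>y. g' y * f y \<partial>\<nu> (\<sigma> \<omega>))" .
qed

section \<open>The transfer relation on the whole tower\<close>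

text \<open>The graph of the transfer operator of the skew product, restricted to those pairs for which a
  jointly measurable function represents the fibrewise images.\<close>

definition transfer_rel :: "('w \<times> 'x \<times> nat \<Rightarrow> real) \<Rightarrow> ('w \<times> 'x \<times> nat \<Rightarrow> real) \<Rightarrow> bool" where
  "transfer_rel \<psi> g \<longleftrightarrow> integrable \<mu> \<psi> \<and> integrable \<mu> g \<and>
     (AE \<omega> in \<P>. is_transfer T \<omega> (curry \<psi> \<omega>) (curry g (\<sigma> \<omega>)))"

lemma AE_integrable_curry:
  assumes "integrable \<mu> (f :: _ \<Rightarrow> real)"
  shows "AE \<omega> in \<P>. integrable (\<nu> \<omega>) (curry f \<omega>)"
  using integrable_tower_fibres(1)[OF assms] by (simp add: curry_def)

lemma transfer_rel_linear:
  assumes "transfer_rel \<psi>1 g1" "transfer_rel \<psi>2 g2"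
  shows "transfer_rel (\<lambda>z. a * \<psi>1 z + b * \<psi>2 z) (\<lambda>z. a * g1 z + b * g2 z)"
proof -
  have int: "integrable \<mu> \<psi>1" "integrable \<mu> \<psi>2" "integrable \<mu> g1" "integrable \<mu> g2"
    and ae: "AE \<omega> in \<P>. is_transfer T \<omega> (curry \<psi>1 \<omega>) (curry g1 (\<sigma> \<omega>))"
    "AE \<omega> in \<P>. is_transfer T \<omega> (curry \<psi>2 \<omega>) (curry g2 (\<sigma> \<omega>))"
    using assms by (auto simp: transfer_rel_def)
  have "AE \<omega> in \<P>. is_transfer T \<omega> (curry (\<lambda>z. a * \<psi>1 z + b * \<psi>2 z) \<omega>) (curry (\<lambda>z. a * g1 z + b * g2 z) (\<sigma> \<omega>))"
    using ae AE_equivariant_at AE_integrable_curry[OF int(1)] AE_integrable_curry[OF int(2)]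
  proof eventually_elim
    case (elim \<omega>)
    from is_transfer_linear[OF elim(3,4,1,5,2), of a b] show ?case by (simp add: curry_def)
  qed
  then show ?thesis using int by (simp add: transfer_rel_def)
qed

text \<open>Convergence in $L^1(\mu)$ implies convergence in $L^1(\mu_\omega)$ for almost every $\omega$ along a
  subsequence.  One subsequence has to serve both functions, hence the sum in \<open>u\<close> below.  On a
  single fibre the defining identity passes to the limit for all test functions at once, so the
  uncountably many test functions cause no trouble.\<close>

lemma transfer_rel_L1_closed:
  assumes rel: "\<And>i. transfer_rel (\<Psi> i) (G i)"
    and int: "integrable \<mu> \<psi>" "integrable \<mu> g"
    and lim: "(\<lambda>i. \<integral>z. \<bar>\<Psi> i z - \<psi> z\<bar> \<partial>\<mu>) \<longlonglongrightarrow> 0" "(\<lambda>i. \<integral>z. \<bar>G i z - g z\<bar> \<partial>\<mu>) \<longlonglongrightarrow> 0"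
  shows "transfer_rel \<psi> g"
proof -
  have int': "integrable \<mu> (\<Psi> i)" "integrable \<mu> (G i)" for i
    using rel by (auto simp: transfer_rel_def)
  have intd: "integrable \<mu> (\<lambda>z. \<Psi> i z - \<psi> z)" "integrable \<mu> (\<lambda>z. G i z - g z)" for i
    using int int' by auto
  define u where "u = (\<lambda>i \<omega>. (\<integral>y. \<bar>\<Psi> i (\<omega>, y) - \<psi> (\<omega>, y)\<bar> \<partial>\<nu> \<omega>) + (\<integral>y. \<bar>G i (\<omega>, y) - g (\<omega>, y)\<bar> \<partial>\<nu> \<omega>))"
  have u0: "norm (u i \<omega>) = u i \<omega>" for i \<omega>
    by (simp add: u_def)
  have u_int: "integrable \<P> (u i)" for i
    unfolding u_def using integrable_tower_fibres(2)[OF intd(1)] integrable_tower_fibres(2)[OF intd(2)]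
    by (intro Bochner_Integration.integrable_add)
  have "(\<integral>\<omega>. norm (u i \<omega>) \<partial>\<P>) = (\<integral>z. \<bar>\<Psi> i z - \<psi> z\<bar> \<partial>\<mu>) + (\<integral>z. \<bar>G i z - g z\<bar> \<partial>\<mu>)" for i
    unfolding u0 unfolding u_def
    using integrable_tower_fibres(2,3)[OF intd(1)] integrable_tower_fibres(2,3)[OF intd(2)]
    by simp
  then have "(\<lambda>i. \<integral>\<omega>. norm (u i \<omega>) \<partial>\<P>) \<longlonglongrightarrow> 0"
    using tendsto_add[OF lim] by simp
  from tendsto_L1_AE_subseq[OF u_int this]
  obtain r :: "nat \<Rightarrow> nat" where r: "AE \<omega> in \<P>. (\<lambda>i. u (r i) \<omega>) \<longlonglongrightarrow> 0" by blast
  have t1: "(\<lambda>i. \<integral>y. \<bar>\<Psi> (r i) (\<omega>, y) - \<psi> (\<omega>, y)\<bar> \<partial>\<nu> \<omega>) \<longlonglongrightarrow> 0"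
    and t2: "(\<lambda>i. \<integral>y. \<bar>G (r i) (\<omega>, y) - g (\<omega>, y)\<bar> \<partial>\<nu> \<omega>) \<longlonglongrightarrow> 0"
    if "(\<lambda>i. u (r i) \<omega>) \<longlonglongrightarrow> 0" for \<omega>
    by (rule Lim_null_comparison[OF _ that], simp add: u_def)+
  have "AE \<omega> in \<P>. \<forall>i. integrable (\<nu> \<omega>) (curry (\<Psi> i) \<omega>)"
    using AE_integrable_curry[OF int'(1)] by (simp add: AE_all_countable)
  moreover have "AE \<omega> in \<P>. \<forall>i. is_transfer T \<omega> (curry (\<Psi> i) \<omega>) (curry (G i) (\<sigma> \<omega>))"
    using rel by (simp add: AE_all_countable transfer_rel_def)
  ultimately have "AE \<omega> in \<P>. is_transfer T \<omega> (curry \<psi> \<omega>) (curry g (\<sigma> \<omega>))"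
    using AE_equivariant_at AE_integrable_curry[OF int(1)] AE_shift[OF AE_integrable_curry[OF int(2)]]
      r AE_shift[OF r]
  proof eventually_elim
    case (elim \<omega>)
    show ?case
      unfolding is_transfer_def
    proof (intro conjI ballI)
      show "integrable (\<nu> (\<sigma> \<omega>)) (curry g (\<sigma> \<omega>))" using elim by simp
      fix f assume f: "f \<in> Linf_space (\<nu> (\<sigma> \<omega>))"
      have "(\<lambda>i. \<integral>y. curry (\<Psi> (r i)) \<omega> y * f (tower_map T \<omega> y) \<partial>\<nu> \<omega>)
          \<longlonglongrightarrow> (\<integral>y. curry \<psi> \<omega> y * f (tower_map T \<omega> y) \<partial>\<nu> \<omega>)"
        by (rule integral_times_Linf_tendsto[OF _ elim(4) Linf_space_tower_map[OF elim(3) f]])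
           (use elim(1) t1[OF elim(6)] in \<open>auto simp: curry_def\<close>)
      also have "(\<lambda>i. \<integral>y. curry (\<Psi> (r i)) \<omega> y * f (tower_map T \<omega> y) \<partial>\<nu> \<omega>)
          = (\<lambda>i. \<integral>y. curry (G (r i)) (\<sigma> \<omega>) y * f y \<partial>\<nu> (\<sigma> \<omega>))"
        using elim(2) f by (simp add: is_transfer_def)
      finally have "(\<lambda>i. \<integral>y. curry (G (r i)) (\<sigma> \<omega>) y * f y \<partial>\<nu> (\<sigma> \<omega>))
          \<longlonglongrightarrow> (\<integral>y. curry \<psi> \<omega> y * f (tower_map T \<omega> y) \<partial>\<nu> \<omega>)" .
      moreover have "(\<lambda>i. \<integral>y. curry (G (r i)) (\<sigma> \<omega>) y * f y \<partial>\<nu> (\<sigma> \<omega>))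
          \<longlonglongrightarrow> (\<integral>y. curry g (\<sigma> \<omega>) y * f y \<partial>\<nu> (\<sigma> \<omega>))"
      proof (rule integral_times_Linf_tendsto[OF _ elim(5) f])
        show "integrable (\<nu> (\<sigma> \<omega>)) (curry (G (r i)) (\<sigma> \<omega>))" for i
          using elim(2) by (simp add: is_transfer_def)
      qed (use t2[OF elim(7)] in \<open>simp add: curry_def\<close>)
      ultimately show "(\<integral>y. curry \<psi> \<omega> y * f (tower_map T \<omega> y) \<partial>\<nu> \<omega>)
          = (\<integral>y. curry g (\<sigma> \<omega>) y * f y \<partial>\<nu> (\<sigma> \<omega>))"
        by (rule LIMSEQ_unique)
    qed
  qed
  then show ?thesis using int by (simp add: transfer_rel_def)
qed

text \<open>$P^k_{\sigma^{-k}\omega} \phi_{\sigma^{-k}\omega}$: the $k$-th iterate of the transfer operator of the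
  skew product, evaluated on the fibre over $\omega$.\<close>

definition past_transfer :: "('w \<times> 'x \<times> nat \<Rightarrow> real) \<Rightarrow> nat \<Rightarrow> 'w \<Rightarrow> 'x \<times> nat \<Rightarrow> real" where
  "past_transfer \<phi> k \<omega> = transfer_iter T k (back_shift T k \<omega>) (curry \<phi> (back_shift T k \<omega>))"

lemma past_transfer_0: "past_transfer \<phi> 0 = curry \<phi>"
  by (simp add: past_transfer_def back_shift_def fun_eq_iff)

lemma past_transfer_Suc_shift:
  assumes "\<omega> \<in> space \<P>"
  shows "past_transfer \<phi> (Suc k) (\<sigma> \<omega>) = transfer T \<omega> (past_transfer \<phi> k \<omega>)"
  by (simp add: past_transfer_def back_shift_Suc_shift[OF assms] shift_funpow_back_shift[OF assms])

lemma AE_integrable_past_transfer: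
  assumes "integrable \<mu> \<phi>"
  shows "AE \<omega> in \<P>. integrable (\<nu> \<omega>) (past_transfer \<phi> k \<omega>)"
proof (induction k)
  case 0
  then show ?case using AE_integrable_curry[OF assms] by (simp only: past_transfer_0)
next
  case (Suc k)
  have "AE \<omega> in \<P>. integrable (\<nu> (\<sigma> \<omega>)) (past_transfer \<phi> (Suc k) (\<sigma> \<omega>))"
    using Suc AE_equivariant_at
  proof eventually_elim
    case (elim \<omega>)
    then show ?case
      using is_transfer_transfer[OF elim(2,1)] past_transfer_Suc_shift[of \<omega> \<phi> k]
      by (simp add: is_transfer_def equivariant_at_def)
  qed
  then show ?case by (rule AE_unshift)
qed

text \<open>$P(\phi + S_n) = S_{n+1}$.  On each fibre, $\phi + S_n$ is the sum of the iterates
  with $0 \le k \le n$, and $P_\omega$ shifts the index by one.\<close>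

lemma transfer_rel_partial_sums:
  assumes \<phi>: "integrable \<mu> \<phi>"
    and S: "integrable \<mu> Sn" "is_version T Sn (\<lambda>\<omega> y. \<Sum>k=1..n. past_transfer \<phi> k \<omega> y)"
    and S': "integrable \<mu> Sn'" "is_version T Sn' (\<lambda>\<omega> y. \<Sum>k=1..Suc n. past_transfer \<phi> k \<omega> y)"
  shows "transfer_rel (\<lambda>z. \<phi> z + Sn z) Sn'"
proof -
  have "AE \<omega> in \<P>. \<forall>k. integrable (\<nu> \<omega>) (past_transfer \<phi> k \<omega>)"
    using AE_integrable_past_transfer[OF \<phi>] by (simp add: AE_all_countable)
  then have "AE \<omega> in \<P>. is_transfer T \<omega> (curry (\<lambda>z. \<phi> z + Sn z) \<omega>) (curry Sn' (\<sigma> \<omega>))"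
    using AE_equivariant_at AE_integrable_curry[OF \<phi>] AE_integrable_curry[OF S(1)]
      AE_shift[OF AE_integrable_curry[OF S'(1)]] S(2)[unfolded is_version_def]
      AE_shift[OF S'(2)[unfolded is_version_def]]
  proof eventually_elim
    case (elim \<omega>)
    have \<omega>: "\<omega> \<in> space \<P>" using elim(2) by (simp add: equivariant_at_def)
    have step: "is_transfer T \<omega> (past_transfer \<phi> k \<omega>) (past_transfer \<phi> (Suc k) (\<sigma> \<omega>))" for k
      unfolding past_transfer_Suc_shift[OF \<omega>] using elim by (intro is_transfer_transfer) auto
    have "is_transfer T \<omega> (\<lambda>y. \<Sum>k<m. past_transfer \<phi> k \<omega> y) (\<lambda>y. \<Sum>k<m. past_transfer \<phi> (Suc k) (\<sigma> \<omega>) y)" for m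
    proof (induction m)
      case 0
      show ?case by (simp add: is_transfer_def)
    next
      case (Suc m)
      have "integrable (\<nu> \<omega>) (\<lambda>y. \<Sum>k<m. past_transfer \<phi> k \<omega> y)" using elim(1) by simp
      from is_transfer_linear[OF elim(2) this Suc _ step, of m 1 1] elim(1)
      show ?case by simp
    qed
    from this[of "Suc n"] show ?case
    proof (rule is_transfer_cong_AE[OF _ elim(2)])
      show "AE y in \<nu> \<omega>. (\<Sum>k<Suc n. past_transfer \<phi> k \<omega> y) = curry (\<lambda>z. \<phi> z + Sn z) \<omega> y"
        using elim(6)
      proof eventually_elim
        case (elim y)
        have "(\<Sum>k<Suc n. past_transfer \<phi> k \<omega> y) = past_transfer \<phi> 0 \<omega> y + (\<Sum>k=1..n. past_transfer \<phi> k \<omega> y)"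
          by (simp only: sum.lessThan_Suc_shift sum.atLeast1_atMost_eq One_nat_def)
        then show ?case using elim by (simp add: past_transfer_0 curry_def)
      qed
      show "AE y in \<nu> (\<sigma> \<omega>). (\<Sum>k<Suc n. past_transfer \<phi> (Suc k) (\<sigma> \<omega>) y) = curry Sn' (\<sigma> \<omega>) y"
        using elim(7)
      proof eventually_elim
        case (elim y)
        have "(\<Sum>k<Suc n. past_transfer \<phi> (Suc k) (\<sigma> \<omega>) y) = (\<Sum>k=1..Suc n. past_transfer \<phi> k (\<sigma> \<omega>) y)"
          by (simp only: sum.atLeast1_atMost_eq One_nat_def)
        then show ?case using elim by simp
      qed
      show "integrable (\<nu> \<omega>) (\<lambda>y. \<Sum>k<Suc n. past_transfer \<phi> k \<omega> y)" using elim(1) by simp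
      show "integrable (\<nu> \<omega>) (curry (\<lambda>z. \<phi> z + Sn z) \<omega>)" using elim(3,4) by (simp add: curry_def)
      show "integrable (\<nu> (\<sigma> \<omega>)) (curry Sn' (\<sigma> \<omega>))" by (rule elim(5))
    qed
  qed
  then show ?thesis using \<phi> S(1) S'(1) by (simp add: transfer_rel_def)
qed

section \<open>A fixed point of the affine transfer map\<close>

text \<open>The function \<open>x\<close> is the mean of $S_0, \dots, S_n$, built recursively as a convex combination of the
  previous mean and the next term, so that two-term convexity suffices.  The defect telescopes to
  $(S_{n+1} - S_0)/(n+1)$.\<close>

lemma cesaro_almost_fixed:
  assumes p: "1 \<le> p"
    and S: "\<And>n. S n \<in> Lp_space p \<mu>" "\<And>n. (\<integral>z. \<bar>S n z\<bar> powr p \<partial>\<mu>) \<le> C"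
    and rel: "\<And>n. transfer_rel (\<lambda>z. \<phi> z + S n z) (S (Suc n))"
  shows "\<exists>x \<in> Lp_space p \<mu>. (\<integral>z. \<bar>x z\<bar> powr p \<partial>\<mu>) \<le> C \<and>
    transfer_rel (\<lambda>z. \<phi> z + x z) (\<lambda>z. x z + (S (Suc n) z - S 0 z) / Suc n)"
proof (induction n)
  case 0
  show ?case
    by (rule bexI[OF _ S(1)[of 0]]) (use S(2)[of 0] rel[of 0] in simp)
next
  case (Suc n)
  then obtain x where x: "x \<in> Lp_space p \<mu>" "(\<integral>z. \<bar>x z\<bar> powr p \<partial>\<mu>) \<le> C"
    and xr: "transfer_rel (\<lambda>z. \<phi> z + x z) (\<lambda>z. x z + (S (Suc n) z - S 0 z) / Suc n)"
    by blast
  define t where "t = 1 / real (Suc (Suc n))"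
  define s where "s = real (Suc n) / real (Suc (Suc n))"
  have st: "0 \<le> s" "0 \<le> t" "s + t = 1" by (auto simp: s_def t_def field_simps)
  have sn: "s / real (Suc n) = t" by (simp add: s_def t_def)
  define x' where "x' = (\<lambda>z. s * x z + t * S (Suc n) z)"
  have "x' \<in> Lp_space p \<mu>"
    unfolding x'_def by (rule Lp_space_combination(1)[OF p x(1) S(1) st])
  moreover have "(\<integral>z. \<bar>x' z\<bar> powr p \<partial>\<mu>) \<le> C"
  proof -
    have "(\<integral>z. \<bar>x' z\<bar> powr p \<partial>\<mu>) \<le> s * (\<integral>z. \<bar>x z\<bar> powr p \<partial>\<mu>) + t * (\<integral>z. \<bar>S (Suc n) z\<bar> powr p \<partial>\<mu>)"
      unfolding x'_def by (rule Lp_space_combination(2)[OF p x(1) S(1) st])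
    also have "\<dots> \<le> s * C + t * C"
      using st x(2) S(2) by (intro add_mono mult_left_mono) auto
    also have "\<dots> = C" using st(3) by (simp flip: distrib_right)
    finally show ?thesis .
  qed
  moreover have "transfer_rel (\<lambda>z. \<phi> z + x' z) (\<lambda>z. x' z + (S (Suc (Suc n)) z - S 0 z) / Suc (Suc n))"
  proof -
    have "(\<lambda>z. s * (\<phi> z + x z) + t * (\<phi> z + S (Suc n) z)) = (\<lambda>z. \<phi> z + x' z)"
    proof
      fix z
      have "s * (\<phi> z + x z) + t * (\<phi> z + S (Suc n) z) = (s + t) * \<phi> z + x' z"
        by (simp add: x'_def algebra_simps)
      then show "s * (\<phi> z + x z) + t * (\<phi> z + S (Suc n) z) = \<phi> z + x' z"
        by (simp add: st(3))
    qed
    moreover have "(\<lambda>z. s * (x z + (S (Suc n) z - S 0 z) / Suc n) + t * S (Suc (Suc n)) z)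
        = (\<lambda>z. x' z + (S (Suc (Suc n)) z - S 0 z) / Suc (Suc n))"
    proof
      fix z
      have "s * (x z + (S (Suc n) z - S 0 z) / Suc n) = s * x z + (s / Suc n) * (S (Suc n) z - S 0 z)"
        by (simp add: distrib_left)
      then show "s * (x z + (S (Suc n) z - S 0 z) / Suc n) + t * S (Suc (Suc n)) z
          = x' z + (S (Suc (Suc n)) z - S 0 z) / Suc (Suc n)"
        unfolding sn by (simp add: x'_def t_def divide_inverse algebra_simps)
    qed
    ultimately show ?thesis
      using transfer_rel_linear[OF xr rel[of "Suc n"], of s t] by simp
  qed
  ultimately show ?case by blast
qed

text \<open>\<open>K n\<close> consists of the points of an $L^p$ ball that $x \mapsto P(\phi + x)$ moves by at most
  $E/(n+1)$ in $L^1$.  A limit of points $x_i \in K_i$ is also the limit of their images, so it is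
  fixed because \<open>transfer_rel\<close> is closed.  The constant \<open>E\<close> bounds
  $\|S_{n+1}\|_1 + \|S_0\|_1$, through $|s| \le 1 + |s|^p$.\<close>

lemma transfer_rel_fixed_point:
  assumes p: "2 \<le> p" and \<phi>: "integrable \<mu> \<phi>"
    and S: "\<And>n. S n \<in> Lp_space p \<mu>" "\<And>n. (\<integral>z. \<bar>S n z\<bar> powr p \<partial>\<mu>) \<le> C"
    and rel: "\<And>n. transfer_rel (\<lambda>z. \<phi> z + S n z) (S (Suc n))"
  shows "\<exists>u \<in> Lp_space p \<mu>. transfer_rel (\<lambda>z. \<phi> z + u z) u"
proof -
  have p1: "1 \<le> p" using p by simp
  have C0: "0 \<le> C"
    by (rule order_trans[OF _ S(2)[of 0]]) simp
  define E where "E = 2 * (1 + C)"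
  define K where "K = (\<lambda>n. {x \<in> Lp_space p \<mu>. (\<integral>z. \<bar>x z\<bar> powr p \<partial>\<mu>) \<le> C \<and>
    (\<exists>g. transfer_rel (\<lambda>z. \<phi> z + x z) g \<and> (\<integral>z. \<bar>g z - x z\<bar> \<partial>\<mu>) \<le> E / Suc n)})"
  have x_int: "integrable \<mu> x" if "x \<in> Lp_space p \<mu>" for x
    by (rule tower.Lp_space_integrable[OF that p1])
  have g_int: "integrable \<mu> g" if "transfer_rel \<psi> g" for \<psi> g
    using that by (simp add: transfer_rel_def)
  have "\<exists>x u. (\<forall>i. x i \<in> K i) \<and> integrable \<mu> u \<and> (AE z in \<mu>. (\<lambda>i. x i z) \<longlonglongrightarrow> u z) \<and>
    (\<lambda>i. \<integral>z. \<bar>x i z - u z\<bar> \<partial>\<mu>) \<longlonglongrightarrow> 0"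
  proof (rule tower.nested_midpoint_convex_L1_limit[where B = "1 + C"])
    show "decseq K"
    proof (rule decseq_SucI, rule subsetI)
      fix n x assume x: "x \<in> K (Suc n)"
      have "E / Suc (Suc n) \<le> E / Suc n"
        using C0 by (intro divide_left_mono) (auto simp: E_def)
      then show "x \<in> K n" using x unfolding K_def by (blast intro: order_trans)
    qed
    show "K n \<noteq> {}" for n
    proof -
      obtain x where x: "x \<in> Lp_space p \<mu>" "(\<integral>z. \<bar>x z\<bar> powr p \<partial>\<mu>) \<le> C"
        and xr: "transfer_rel (\<lambda>z. \<phi> z + x z) (\<lambda>z. x z + (S (Suc n) z - S 0 z) / Suc n)"
        using cesaro_almost_fixed[of p S C \<phi> n, OF p1 S rel] by blast
      have si: "integrable \<mu> (S n)" "(\<integral>z. \<bar>S n z\<bar> \<partial>\<mu>) \<le> 1 + C" for n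
        using x_int[OF S(1)] tower.Lp_space_L1_le[OF S(1) p1, of n] S(2)[of n] by auto
      have "(\<integral>z. \<bar>(S (Suc n) z - S 0 z) / Suc n\<bar> \<partial>\<mu>) \<le> (\<integral>z. (\<bar>S (Suc n) z\<bar> + \<bar>S 0 z\<bar>) / Suc n \<partial>\<mu>)"
      proof (rule integral_mono)
        show "\<bar>(S (Suc n) z - S 0 z) / Suc n\<bar> \<le> (\<bar>S (Suc n) z\<bar> + \<bar>S 0 z\<bar>) / Suc n" for z
          unfolding abs_divide by (simp add: divide_right_mono abs_triangle_ineq4)
      qed (use si in auto)
      also have "\<dots> = ((\<integral>z. \<bar>S (Suc n) z\<bar> \<partial>\<mu>) + (\<integral>z. \<bar>S 0 z\<bar> \<partial>\<mu>)) / Suc n"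
        using si(1) by simp
      also have "\<dots> \<le> E / Suc n"
        using si(2)[of "Suc n"] si(2)[of 0] by (intro divide_right_mono) (auto simp: E_def)
      finally have "x \<in> K n"
        using x xr unfolding K_def by (auto intro!: exI[of _ "\<lambda>z. x z + (S (Suc n) z - S 0 z) / Suc n"])
      then show ?thesis by blast
    qed
    show "(\<lambda>z. (x z + y z) / 2) \<in> K n" if x: "x \<in> K n" and y: "y \<in> K n" for n x y
    proof -
      obtain g h where g: "transfer_rel (\<lambda>z. \<phi> z + x z) g" "(\<integral>z. \<bar>g z - x z\<bar> \<partial>\<mu>) \<le> E / Suc n"
        and h: "transfer_rel (\<lambda>z. \<phi> z + y z) h" "(\<integral>z. \<bar>h z - y z\<bar> \<partial>\<mu>) \<le> E / Suc n"
        using x y by (auto simp: K_def)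
      have xy: "x \<in> Lp_space p \<mu>" "y \<in> Lp_space p \<mu>"
        and xy': "(\<integral>z. \<bar>x z\<bar> powr p \<partial>\<mu>) \<le> C" "(\<integral>z. \<bar>y z\<bar> powr p \<partial>\<mu>) \<le> C"
        using x y by (auto simp: K_def)
      define w where "w = (\<lambda>z. (1/2) * x z + (1/2) * y z)"
      have "w \<in> Lp_space p \<mu>" "(\<integral>z. \<bar>w z\<bar> powr p \<partial>\<mu>) \<le> C"
        using Lp_space_combination[OF p1 xy, of "1/2" "1/2"] xy' by (auto simp: w_def)
      moreover have "transfer_rel (\<lambda>z. \<phi> z + w z) (\<lambda>z. (1/2) * g z + (1/2) * h z)"
      proof -
        have "(\<lambda>z. (1/2) * (\<phi> z + x z) + (1/2) * (\<phi> z + y z)) = (\<lambda>z. \<phi> z + w z)"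
          by (simp add: w_def fun_eq_iff field_simps)
        then show ?thesis using transfer_rel_linear[OF g(1) h(1), of "1/2" "1/2"] by simp
      qed
      moreover have "(\<integral>z. \<bar>((1/2) * g z + (1/2) * h z) - w z\<bar> \<partial>\<mu>) \<le> E / Suc n"
      proof -
        note i = x_int[OF xy(1)] x_int[OF xy(2)] g_int[OF g(1)] g_int[OF h(1)]
        have "(\<integral>z. \<bar>((1/2) * g z + (1/2) * h z) - w z\<bar> \<partial>\<mu>)
            \<le> (\<integral>z. (1/2) * \<bar>g z - x z\<bar> + (1/2) * \<bar>h z - y z\<bar> \<partial>\<mu>)"
        proof (rule integral_mono)
          fix z
          have "((1/2) * g z + (1/2) * h z) - w z = (1/2) * (g z - x z) + (1/2) * (h z - y z)"
            by (simp add: w_def field_simps)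
          then show "\<bar>((1/2) * g z + (1/2) * h z) - w z\<bar> \<le> (1/2) * \<bar>g z - x z\<bar> + (1/2) * \<bar>h z - y z\<bar>"
            using abs_triangle_ineq[of "(1/2) * (g z - x z)" "(1/2) * (h z - y z)"]
            by (simp add: abs_mult)
        qed (use i in \<open>auto simp: w_def\<close>)
        also have "\<dots> = (1/2) * (\<integral>z. \<bar>g z - x z\<bar> \<partial>\<mu>) + (1/2) * (\<integral>z. \<bar>h z - y z\<bar> \<partial>\<mu>)"
          using i by simp
        also have "\<dots> \<le> E / Suc n" using g(2) h(2) by simp
        finally show ?thesis .
      qed
      ultimately have "w \<in> K n" unfolding K_def by blast
      moreover have "w = (\<lambda>z. (x z + y z) / 2)" by (simp add: w_def fun_eq_iff)
      ultimately show ?thesis by simp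
    qed
    show "x \<in> borel_measurable \<mu>" "integrable \<mu> (\<lambda>z. (x z)\<^sup>2)" "(\<integral>z. (x z)\<^sup>2 \<partial>\<mu>) \<le> 1 + C"
      if "x \<in> K 0" for x
    proof -
      have x: "x \<in> Lp_space p \<mu>" "(\<integral>z. \<bar>x z\<bar> powr p \<partial>\<mu>) \<le> C"
        using that by (auto simp: K_def)
      then show "x \<in> borel_measurable \<mu>" by (simp add: Lp_space_def)
      have sq: "\<bar>x z\<bar> powr 2 = (x z)\<^sup>2" for z by (simp add: powr_numeral)
      show "integrable \<mu> (\<lambda>z. (x z)\<^sup>2)" "(\<integral>z. (x z)\<^sup>2 \<partial>\<mu>) \<le> 1 + C"
        using tower.Lp_space_integrable_powr[OF x(1) _ p] tower.Lp_space_integral_powr_le[OF x(1) _ p] x(2)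
        by (auto simp: sq)
    qed
  qed
  then obtain x u where xK: "\<And>i. x i \<in> K i" and u: "integrable \<mu> u"
    and ae: "AE z in \<mu>. (\<lambda>i. x i z) \<longlonglongrightarrow> u z"
    and xu: "(\<lambda>i. \<integral>z. \<bar>x i z - u z\<bar> \<partial>\<mu>) \<longlonglongrightarrow> 0"
    by blast
  have "\<exists>g. \<forall>i. transfer_rel (\<lambda>z. \<phi> z + x i z) (g i) \<and> (\<integral>z. \<bar>g i z - x i z\<bar> \<partial>\<mu>) \<le> E / Suc i"
    using xK by (intro choice) (auto simp: K_def)
  then obtain g where gr: "\<And>i. transfer_rel (\<lambda>z. \<phi> z + x i z) (g i)"
    and gx: "\<And>i. (\<integral>z. \<bar>g i z - x i z\<bar> \<partial>\<mu>) \<le> E / Suc i" by blast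
  have xL: "x i \<in> Lp_space p \<mu>" "(\<integral>z. \<bar>x i z\<bar> powr p \<partial>\<mu>) \<le> C" for i
    using xK[of i] by (auto simp: K_def)
  have "u \<in> Lp_space p \<mu>"
    by (rule Lp_space_AE_limit[OF _ _ xL ae]) (use p u in auto)
  moreover have "transfer_rel (\<lambda>z. \<phi> z + u z) u"
  proof (rule transfer_rel_L1_closed[OF gr])
    show "(\<lambda>i. \<integral>z. \<bar>g i z - u z\<bar> \<partial>\<mu>) \<longlonglongrightarrow> 0"
    proof (rule Lim_null_comparison)
      have "(\<integral>z. \<bar>g i z - u z\<bar> \<partial>\<mu>) \<le> E / Suc i + (\<integral>z. \<bar>x i z - u z\<bar> \<partial>\<mu>)" for i
      proof -
        note i = x_int[OF xL(1)[of i]] g_int[OF gr[of i]] u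
        have "(\<integral>z. \<bar>g i z - u z\<bar> \<partial>\<mu>) \<le> (\<integral>z. \<bar>g i z - x i z\<bar> + \<bar>x i z - u z\<bar> \<partial>\<mu>)"
        proof (rule integral_mono)
          show "\<bar>g i z - u z\<bar> \<le> \<bar>g i z - x i z\<bar> + \<bar>x i z - u z\<bar>" for z
            using abs_triangle_ineq[of "g i z - x i z" "x i z - u z"] by simp
        qed (use i in auto)
        also have "\<dots> = (\<integral>z. \<bar>g i z - x i z\<bar> \<partial>\<mu>) + (\<integral>z. \<bar>x i z - u z\<bar> \<partial>\<mu>)"
          using i by simp
        finally show ?thesis using gx[of i] by linarith
      qed
      then show "\<forall>\<^sub>F i in sequentially. norm (\<integral>z. \<bar>g i z - u z\<bar> \<partial>\<mu>) \<le> E / Suc i + (\<integral>z. \<bar>x i z - u z\<bar> \<partial>\<mu>)"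
        by (intro always_eventually) simp
      have "(\<lambda>i. E * (1 / Suc i)) \<longlonglongrightarrow> E * 0"
        by (intro tendsto_mult tendsto_const LIMSEQ_Suc[OF lim_1_over_n])
      then show "(\<lambda>i. E / Suc i + (\<integral>z. \<bar>x i z - u z\<bar> \<partial>\<mu>)) \<longlonglongrightarrow> 0"
        using tendsto_add[OF _ xu, of "\<lambda>i. E / Suc i" 0] by simp
    qed
    show "(\<lambda>i. \<integral>z. \<bar>(\<phi> z + x i z) - (\<phi> z + u z)\<bar> \<partial>\<mu>) \<longlonglongrightarrow> 0" using xu by simp
  qed (use \<phi> u in auto)
  ultimately show ?thesis by blast
qed

section \<open>The martingale-coboundary decomposition\<close>

text \<open>$P_\omega(\phi + u)_\omega$ and $P_\omega (u_{\sigma\omega} \circ F_\omega)$ both equal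
  $u_{\sigma\omega}$, so their difference vanishes.\<close>

lemma ker_transfer_coboundary:
  assumes rel: "transfer_rel (\<lambda>z. \<phi> z + u z) u"
    and int: "integrable \<mu> \<phi>" "integrable \<mu> u"
  shows "AE \<omega> in \<P>. curry (\<lambda>z. \<phi> z - u (skew_map z) + u z) \<omega> \<in> ker_transfer T \<omega>"
proof -
  have "AE \<omega> in \<P>. is_transfer T \<omega> (curry (\<lambda>z. \<phi> z + u z) \<omega>) (curry u (\<sigma> \<omega>))"
    using rel by (simp add: transfer_rel_def)
  then show ?thesis
    using AE_equivariant_at AE_integrable_curry[OF int(1)] AE_integrable_curry[OF int(2)]
      AE_shift[OF AE_integrable_curry[OF int(2)]]
  proof eventually_elim
    case (elim \<omega>)
    let ?v = "\<lambda>y. curry u (\<sigma> \<omega>) (tower_map T \<omega> y)"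
    let ?\<psi> = "curry (\<lambda>z. \<phi> z - u (skew_map z) + u z) \<omega>"
    note F = shift_fibre_facts[OF elim(2)]
    have "integrable (\<nu> \<omega>) (curry (\<lambda>z. \<phi> z + u z) \<omega>)"
      using elim(3,4) by (simp add: curry_def)
    moreover have v: "integrable (\<nu> \<omega>) ?v"
      by (rule integrable_distr[OF F(2)]) (unfold F(3), rule elim(5))
    ultimately have "is_transfer T \<omega> (\<lambda>y. 1 * curry (\<lambda>z. \<phi> z + u z) \<omega> y + (-1) * ?v y)
        (\<lambda>y. 1 * curry u (\<sigma> \<omega>) y + (-1) * curry u (\<sigma> \<omega>) y)"
      by (intro is_transfer_linear[OF elim(2)] elim(1) is_transfer_composition[OF elim(2,5)])
    moreover have "(\<lambda>y. 1 * curry (\<lambda>z. \<phi> z + u z) \<omega> y + (-1) * ?v y) = ?\<psi>"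
      by (auto simp: curry_def skew_map_apply)
    ultimately have zero: "is_transfer T \<omega> ?\<psi> (\<lambda>y. 0)" by simp
    have \<psi>: "integrable (\<nu> \<omega>) ?\<psi>"
      using elim(3,4) v by (simp add: curry_def skew_map_apply)
    show ?case
      unfolding ker_transfer_def
      using \<psi> is_transfer_unique[OF is_transfer_transfer[OF elim(2) \<psi>] zero] by simp
  qed
qed

end

theorem lemma4p2:
  fixes T :: "('w, 'x) tower_data"
    and p :: real
    and \<phi> :: "'w \<times> 'x \<times> nat \<Rightarrow> real"
    and S :: "nat \<Rightarrow> 'w \<times> 'x \<times> nat \<Rightarrow> real"
  assumes "random_tower T"
    and "2 \<le> p"
    and "\<phi> \<in> Lp_space p (tower_measure T)"
    and "AE \<omega> in base_prob T. (\<integral>y. curry \<phi> \<omega> y \<partial>fib_measure T \<omega>) = 0"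
    and "\<And>n. S n \<in> Lp_space p (tower_measure T)"
    and "\<And>n. is_version T (S n)
           (\<lambda>\<omega> y. \<Sum>k=1..n. transfer_iter T k (back_shift T k \<omega>) (curry \<phi> (back_shift T k \<omega>)) y)"
    and "(\<lambda>n. Lp_norm p (tower_measure T) (S n)) \<in> O(\<lambda>_. 1)"
  shows "\<exists>psi chi. psi \<in> Lp_space p (tower_measure T) \<and> chi \<in> Lp_space p (tower_measure T) \<and>
    (AE \<omega> in base_prob T.
       (AE y in fib_measure T \<omega>.
          curry psi \<omega> y = curry \<phi> \<omega> y - curry chi (base_shift T \<omega>) (tower_map T \<omega> y) + curry chi \<omega> y) \<and>
       curry psi \<omega> \<in> ker_transfer T \<omega>)"
proof -
  interpret random_tower T by (rule assms(1))
  have p: "1 \<le> p" "0 < p" using assms(2) by auto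
  note int = tower.Lp_space_integrable[OF _ p(1)]
  obtain C where C: "\<And>n. (\<integral>z. \<bar>S n z\<bar> powr p \<partial>\<mu>) \<le> C"
    using Lp_norm_bounded_imp[OF p(2) assms(7)] by blast
  have "transfer_rel (\<lambda>z. \<phi> z + S n z) (S (Suc n))" for n
    using assms(6)[of n] assms(6)[of "Suc n"] unfolding past_transfer_def[symmetric]
    by (intro transfer_rel_partial_sums int assms(3,5))
  then obtain chi where chi: "chi \<in> Lp_space p \<mu>" "transfer_rel (\<lambda>z. \<phi> z + chi z) chi"
    using transfer_rel_fixed_point[OF assms(2) int[OF assms(3)] assms(5) C] by blast
  define psi where "psi = (\<lambda>z. \<phi> z - chi (skew_map z) + chi z)"
  have "(\<lambda>z. (\<phi> z + chi z) + (-1) * chi (skew_map z)) \<in> Lp_space p \<mu>"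
    by (intro Lp_space_add Lp_space_scale Lp_space_skew_map p assms(3) chi(1))
  then have "psi \<in> Lp_space p \<mu>"
    by (simp add: psi_def algebra_simps)
  moreover have "AE \<omega> in \<P>. (AE y in \<nu> \<omega>.
      curry psi \<omega> y = curry \<phi> \<omega> y - curry chi (\<sigma> \<omega>) (tower_map T \<omega> y) + curry chi \<omega> y) \<and>
      curry psi \<omega> \<in> ker_transfer T \<omega>"
    using ker_transfer_coboundary[OF chi(2) int[OF assms(3)] int[OF chi(1)]]
    by eventually_elim (simp add: psi_def skew_map_apply)
  ultimately show ?thesis using chi(1) by blast
qed

end
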